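(* Let $k$ be a field, let $X=(x_{i,j})$, $1\le i\le m$, $1\le j\le n$, be a generic $m\times n$ matrix, and let $R=k[X]=k[x_{i,j}]$. Regard $X$ as a block matrix $X=(A\,B)$, where $A$ has size $m\times a$ and $B$ has size $m\times(n-a)$. Let $J\subseteq R$ be the ideal generated by the set of $t$-minors of $X$ that involve at least $r$ columns of $A$, let $I_t(X)$ be the ideal generated by the $t$-minors of $X$, and similarly let $I_r(A)$ be the ideal generated by the $r$-minors of $A$. Then $$J=I_t(X)\cap I_r(A).$$
   Context: A generic matrix is one whose entries $x_{i,j}$ are independent variables over the base ring. A $t$-minor of a matrix is the determinant of a $t\times t$ submatrix, given by a choice of $t$ distinct rows and $t$ distinct columns. All ideals are ideals of $R$.
   Formalization: The formal theorem adds the assumption r ≤ t; without it the claim fails, e.g. for m = n = a = 2, t = 1, r = 2, where J = 0 but the intersection of I_1(X) and I_2(A) is generated by det X. *)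

theory Defs
  imports
    "HOL-Library.Poly_Mapping"
    "HOL-Algebra.Ideal"
    "Jordan_Normal_Form.Determinant"
    "Jordan_Normal_Form.DL_Submatrix"
begin

text \<open>
  Polynomials over a field in variables indexed by pairs of naturals: a monomial is a finitely
  supported exponent vector, a polynomial a finitely supported family of coefficients, and
  \<open>*\<close> on these types is convolution. Matrix indices start at 0, following
  \<^typ>\<open>'a mat\<close>.
\<close>

type_synonym 'k var_poly = "((nat \<times> nat) \<Rightarrow>\<^sub>0 nat) \<Rightarrow>\<^sub>0 'k"

definition var :: "nat \<Rightarrow> nat \<Rightarrow> 'k::field var_poly" where
  "var i j = Poly_Mapping.single (Poly_Mapping.single (i, j) 1) 1"

text \<open>
  The type has infinitely many variables; \<open>k[x_ij]\<close> for an \<open>m\<close> by \<open>n\<close> matrix is the subring of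
  polynomials in which only the variables with \<open>i < m\<close> and \<open>j < n\<close> occur.
\<close>

definition poly_ring :: "nat \<Rightarrow> nat \<Rightarrow> 'k::field var_poly ring" where
  "poly_ring m n =
    \<lparr>carrier = {p. \<forall>\<mu>\<in>Poly_Mapping.keys p. Poly_Mapping.keys \<mu> \<subseteq> {..<m} \<times> {..<n}},
     monoid.mult = (*), one = 1, zero = 0, add = (+)\<rparr>"

definition generic_mat :: "nat \<Rightarrow> nat \<Rightarrow> 'k::field var_poly mat" where
  "generic_mat m n = mat m n (\<lambda>(i, j). var i j)"

text \<open>
  A minor is taken with its rows and columns in increasing order; reordering them only changes its
  sign. The only 0-minor is 1.
\<close>

definition minors :: "nat \<Rightarrow> 'a::comm_ring_1 mat \<Rightarrow> 'a set" where
  "minors t M = {det (submatrix M I J) | I J.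
     I \<subseteq> {..<dim_row M} \<and> card I = t \<and> J \<subseteq> {..<dim_col M} \<and> card J = t}"

definition minors_involving :: "nat \<Rightarrow> nat \<Rightarrow> nat set \<Rightarrow> 'a::comm_ring_1 mat \<Rightarrow> 'a set" where
  "minors_involving t r C M = {det (submatrix M I J) | I J.
     I \<subseteq> {..<dim_row M} \<and> card I = t \<and> J \<subseteq> {..<dim_col M} \<and> card J = t \<and> r \<le> card (J \<inter> C)}"

lemma cring_poly_ring: "cring (poly_ring m n :: 'k::field var_poly ring)"
proof -
  let ?V = "{..<m} \<times> {..<n}"
  let ?C = "{p :: 'k var_poly. \<forall>\<mu>\<in>Poly_Mapping.keys p. Poly_Mapping.keys \<mu> \<subseteq> ?V}"
  have add: "p + q \<in> ?C" if "p \<in> ?C" "q \<in> ?C" for p q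
    using that Poly_Mapping.keys_add[of p q] by blast
  have mult: "p * q \<in> ?C" if "p \<in> ?C" "q \<in> ?C" for p q
  proof (intro CollectI ballI subsetI)
    fix \<mu> v
    assume "\<mu> \<in> Poly_Mapping.keys (p * q)" and v: "v \<in> Poly_Mapping.keys \<mu>"
    then obtain \<alpha> \<beta> where \<mu>: "\<mu> = \<alpha> + \<beta>" "\<alpha> \<in> Poly_Mapping.keys p" "\<beta> \<in> Poly_Mapping.keys q"
      using Poly_Mapping.keys_mult[of p q] by blast
    have "Poly_Mapping.keys \<mu> \<subseteq> Poly_Mapping.keys \<alpha> \<union> Poly_Mapping.keys \<beta>"
      unfolding \<mu>(1) by (rule Poly_Mapping.keys_add)
    then show "v \<in> ?V"
      using that \<mu> v by blast
  qed
  have inv: "\<exists>q\<in>?C. q + p = 0" if "p \<in> ?C" for p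
    by (rule bexI[of _ "- p"]) (use that in simp_all)
  have zero_one: "0 \<in> ?C" "1 \<in> ?C"
    by auto
  show ?thesis
  proof (rule cringI)
    show "abelian_group (poly_ring m n :: 'k var_poly ring)"
      by (rule abelian_groupI, unfold poly_ring_def ring_record_simps partial_object.simps)
        (fact add zero_one inv | simp add: algebra_simps)+
    show "comm_monoid (poly_ring m n :: 'k var_poly ring)"
      by (rule comm_monoidI, unfold poly_ring_def monoid.simps partial_object.simps)
        (fact mult zero_one | simp add: algebra_simps)+
  qed (simp add: poly_ring_def algebra_simps)
qed

lemma var_in_poly_ring: "i < m \<Longrightarrow> j < n \<Longrightarrow> var i j \<in> carrier (poly_ring m n)"
  by (simp add: var_def poly_ring_def)

end

theory Submission
  imports Defs "HOL-Library.Product_Lexorder"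
begin

text \<open>
  Border \<open>X\<close> by an identity matrix: \<open>Y = (X | 1)\<close>, with \<open>n + m\<close> columns, the last \<open>m\<close> of them being
  unit vectors. A \<^emph>\<open>bracket\<close> is a maximal minor of \<open>Y\<close>; it is given by a set \<open>C\<close> of \<open>m\<close> columns.
  Expanding along the unit columns shows that the brackets are, up to sign, precisely the minors
  of \<open>X\<close> of all sizes: \<open>C\<close> stands for the minor with columns \<open>C \<inter> {..<n}\<close> and with those rows
  whose unit vector is missing from \<open>C\<close>. For \<open>r \<le> t\<close> let \<open>J(t, r)\<close> be the ideal generated by the
  \<open>t\<close>-minors with at least \<open>r\<close> columns in \<open>A\<close>. Then \<open>I_t(X) = J(t, 0)\<close> and \<open>I_r(A) = J(r, r)\<close>, so that
  the claim is \<open>J(t, r) = J(t, 0) \<inter> J(r, r)\<close>.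

  The reason is that all these ideals are spanned, over the field, by parts of one and the same
  basis of \<open>k[X]\<close>. Order the brackets by \<open>C \<preceq> D\<close> iff, for every \<open>x\<close>, at least as many columns of
  \<open>C\<close> as of \<open>D\<close> lie below \<open>x\<close>; call a product of brackets standard if its factors form a chain.

  \<^item> Straightening: a product of brackets is a linear combination of standard products whose first
    factor precedes or equals the first factor of the given product. If \<open>C \<preceq> D\<close> fails at \<open>x\<close>, then
    the columns of \<open>C\<close> from \<open>x\<close> on and the columns of \<open>D\<close> below \<open>x\<close> are more than \<open>m\<close> vectors of length
    \<open>m\<close>, so the alternating sum over all ways to deal them out to the two brackets vanishes
    (lemma \<open>exchange\<close>). All other terms of this relation have a smaller first factor.

  \<^item> Independence: standard products without the trivial bracket \<open>{n..<n + m}\<close>, which equals \<open>1\<close>,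
    are linearly independent. Substituting for \<open>X\<close> the matrix \<open>G\<inverse> X\<close>, with \<open>G\<close> a generic lower
    unitriangular matrix, turns the brackets into the maximal minors of \<open>(X | G)\<close>. In a suitable
    grading the lowest term of such a minor is its diagonal product, and a chain can be read off
    from the product of the diagonal monomials of its members.

  An ideal \<open>J(t, r)\<close> contains every bracket \<open>C\<close> with \<open>t \<le> card (C \<inter> {..<n})\<close> and
  \<open>r \<le> card (C \<inter> {..<a})\<close>, by expanding along superfluous columns. These two conditions are inherited
  by predecessors, so straightening shows that \<open>J(t, r)\<close> is spanned by the standard products whose
  first factor satisfies them. For a basis, the intersection of the spans of two parts is the span
  of their intersection; and, since \<open>card (C \<inter> {..<a}) \<le> card (C \<inter> {..<n})\<close> and \<open>r \<le> t\<close>, the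
  conditions for \<open>(t, 0)\<close> and \<open>(r, r)\<close> together amount to the condition for \<open>(t, r)\<close>.
\<close>

section \<open>Determinants of matrices given by their entries\<close>

abbreviation fdet :: "nat \<Rightarrow> (nat \<Rightarrow> nat \<Rightarrow> 'a) \<Rightarrow> 'a::comm_ring_1" where
  "fdet m f \<equiv> det (mat m m (\<lambda>(i, j). f i j))"

lemma fdet_cong:
  assumes "\<And>i j. i < m \<Longrightarrow> j < m \<Longrightarrow> f i j = g i j"
  shows "fdet m f = fdet m g"
  using assms by (intro arg_cong[of _ _ det]) auto

lemma fdet_leibniz:
  "fdet m f = (\<Sum>p | p permutes {0..<m}. signof p * (\<Prod>i = 0..<m. f i (p i)))"
proof -
  have "fdet m f = (\<Sum>p | p permutes {0..<m}.
      signof p * (\<Prod>i = 0..<m. mat m m (\<lambda>(i, j). f i j) $$ (i, p i)))"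
    by (rule det_def') simp
  also have "\<dots> = (\<Sum>p | p permutes {0..<m}. signof p * (\<Prod>i = 0..<m. f i (p i)))"
    by (intro sum.cong refl arg_cong2[of _ _ _ _ "(*)"] prod.cong)
      (auto simp: permutes_in_image)
  finally show ?thesis .
qed

lemma fdet_transpose: "fdet m (\<lambda>i j. f j i) = fdet m f"
proof -
  have "transpose_mat (mat m m (\<lambda>(i, j). f i j)) = mat m m (\<lambda>(i, j). f j i)"
    by auto
  then show ?thesis
    using det_transpose[of "mat m m (\<lambda>(i, j). f i j)" m] by simp
qed

lemma fdet_leibniz_cols:
  "fdet m f = (\<Sum>p | p permutes {0..<m}. signof p * (\<Prod>i = 0..<m. f (p i) i))"
  by (rule trans[OF fdet_transpose[symmetric] fdet_leibniz])

lemma fdet_permute_rows: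
  assumes "p permutes {0..<m}"
  shows "fdet m (\<lambda>i j. f (p i) j) = signof p * fdet m f"
proof -
  have "fdet m (\<lambda>i j. f (p i) j) = det (mat m m (\<lambda>(i, j). mat m m (\<lambda>(i, j). f i j) $$ (p i, j)))"
    using assms by (intro fdet_cong) (auto simp: permutes_in_image)
  then show ?thesis
    using det_permute_rows[OF _ assms, of "mat m m (\<lambda>(i, j). f i j)"] by simp
qed

lemma fdet_permute_cols:
  assumes "p permutes {0..<m}"
  shows "fdet m (\<lambda>i j. f i (p j)) = signof p * fdet m f"
proof -
  have "fdet m (\<lambda>i j. f i (p j)) = fdet m (\<lambda>i j. f j (p i))"
    by (rule fdet_transpose)
  also have "\<dots> = signof p * fdet m (\<lambda>i j. f j i)"
    by (rule fdet_permute_rows[OF assms])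
  also have "fdet m (\<lambda>i j. f j i) = fdet m f"
    by (rule fdet_transpose)
  finally show ?thesis .
qed

lemma signof_cases: "signof p = (1::'a::comm_ring_1) \<or> signof p = (- 1 :: 'a)"
  by (auto simp: sign_def)

lemma enumerations_permute:
  fixes \<kappa> \<kappa>' :: "nat \<Rightarrow> 'b"
  assumes "inj_on \<kappa> {..<m}" "inj_on \<kappa>' {..<m}" "\<kappa> ` {..<m} = \<kappa>' ` {..<m}"
  obtains p where "p permutes {0..<m}" "\<And>j. j < m \<Longrightarrow> \<kappa> j = \<kappa>' (p j)"
proof
  let ?p = "\<lambda>j. if j < m then inv_into {..<m} \<kappa>' (\<kappa> j) else j"
  have b: "bij_betw (inv_into {..<m} \<kappa>' \<circ> \<kappa>) {..<m} {..<m}"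
    using assms by (metis bij_betw_inv_into bij_betw_trans inj_on_imp_bij_betw)
  have "bij_betw ?p {0..<m} {0..<m}"
    using b by (subst bij_betw_cong[where g = "inv_into {..<m} \<kappa>' \<circ> \<kappa>"])
      (auto simp: atLeast0LessThan)
  then show "?p permutes {0..<m}"
    by (intro bij_imp_permutes) auto
  show "\<kappa> j = \<kappa>' (?p j)" if "j < m" for j
  proof -
    have "\<kappa> j \<in> \<kappa>' ` {..<m}"
      using that assms(3) by blast
    then show ?thesis
      using that by (simp add: f_inv_into_f)
  qed
qed

text \<open>
  Brackets are only ever needed up to sign, so no lemma below keeps track of the sign of a
  permutation of rows or columns.
\<close>

lemma fdet_reindex:
  fixes f :: "'b \<Rightarrow> 'c \<Rightarrow> 'a::comm_ring_1"
  assumes "inj_on \<rho> {..<m}" "inj_on \<rho>' {..<m}" "\<rho> ` {..<m} = \<rho>' ` {..<m}"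
    and "inj_on \<kappa> {..<m}" "inj_on \<kappa>' {..<m}" "\<kappa> ` {..<m} = \<kappa>' ` {..<m}"
  shows "fdet m (\<lambda>i j. f (\<rho> i) (\<kappa> j)) \<in>
    {fdet m (\<lambda>i j. f (\<rho>' i) (\<kappa>' j)), - fdet m (\<lambda>i j. f (\<rho>' i) (\<kappa>' j))}"
proof -
  obtain p where p: "p permutes {0..<m}" "\<And>j. j < m \<Longrightarrow> \<rho> j = \<rho>' (p j)"
    using enumerations_permute assms(1-3) by metis
  obtain q where q: "q permutes {0..<m}" "\<And>j. j < m \<Longrightarrow> \<kappa> j = \<kappa>' (q j)"
    using enumerations_permute assms(4-6) by metis
  have "fdet m (\<lambda>i j. f (\<rho> i) (\<kappa> j)) = fdet m (\<lambda>i j. f (\<rho>' (p i)) (\<kappa>' (q j)))"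
    using p q by (intro fdet_cong) auto
  also have "\<dots> = signof p * (signof q * fdet m (\<lambda>i j. f (\<rho>' i) (\<kappa>' j)))"
    unfolding fdet_permute_rows[OF p(1), of "\<lambda>i j. f (\<rho>' i) (\<kappa>' (q j))"]
    by (subst fdet_permute_cols[OF q(1), of "\<lambda>i j. f (\<rho>' i) (\<kappa>' j)"]) simp
  finally show ?thesis
    using signof_cases[of p, where ?'a = 'a] signof_cases[of q, where ?'a = 'a] by auto
qed

text \<open>
  A permutation cannot send the columns \<open>K\<close> injectively into the fewer rows \<open>H\<close>, so that each
  product in the Leibniz formula contains a zero.
\<close>

lemma fdet_eq_0_pigeonhole:
  assumes "K \<subseteq> {..<m}" "H \<subseteq> {..<m}" "card H < card K"
    and zero: "\<And>i j. i < m \<Longrightarrow> i \<notin> H \<Longrightarrow> j \<in> K \<Longrightarrow> f i j = 0"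
  shows "fdet m f = 0"
proof -
  have "(\<Prod>i = 0..<m. f i (p i)) = 0" if p: "p permutes {0..<m}" for p
  proof -
    let ?q = "Hilbert_Choice.inv p"
    have "\<not> ?q ` K \<subseteq> H"
    proof
      assume "?q ` K \<subseteq> H"
      then have "card (?q ` K) \<le> card H"
        using finite_subset[OF assms(2)] by (intro card_mono) auto
      moreover have "card (?q ` K) = card K"
        by (rule card_image[OF inj_on_subset[OF permutes_inj[OF permutes_inv[OF p]] subset_UNIV]])
      ultimately show False using assms(3) by simp
    qed
    then obtain j where j: "j \<in> K" "?q j \<notin> H" by auto
    moreover have "?q j < m"
      using j assms(1) permutes_in_image[OF permutes_inv[OF p], of j] by auto
    moreover have "p (?q j) = j"
      by (rule permutes_inverses(1)[OF p])
    ultimately have "f (?q j) (p (?q j)) = 0"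
      using zero by simp
    with \<open>?q j < m\<close> show ?thesis
      by (intro prod_zero) auto
  qed
  then show ?thesis
    unfolding fdet_leibniz by (intro sum.neutral) auto
qed

lemma fdet_identical_cols:
  assumes "i \<noteq> j" "i < m" "j < m" "\<And>k. k < m \<Longrightarrow> f k i = f k j"
  shows "fdet m f = 0"
  by (rule det_identical_columns[OF _ assms(1-3)]) (use assms in auto)

text \<open>
  The polynomials to which this is applied form an integral domain by the lexicographic order on the
  indices of the variables, which induces an order of the monomials compatible with multiplication.
\<close>

lemma fdet_block:
  fixes f :: "nat \<Rightarrow> nat \<Rightarrow> 'a::idom"
  assumes "\<And>i j. k \<le> i \<Longrightarrow> i < k + l \<Longrightarrow> j < k \<Longrightarrow> f i j = 0"
  shows "fdet (k + l) f = fdet k f * fdet l (\<lambda>i j. f (k + i) (k + j))"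
proof -
  have "mat (k + l) (k + l) (\<lambda>(i, j). f i j) =
    four_block_mat (mat k k (\<lambda>(i, j). f i j)) (mat k l (\<lambda>(i, j). f i (k + j)))
      (0\<^sub>m l k) (mat l l (\<lambda>(i, j). f (k + i) (k + j)))"
    using assms by (intro eq_matI) auto
  then show ?thesis
    by (simp add: det_four_block_mat_lower_left_zero[where n = k and m = l])
qed

lemma pick_enumerates:
  assumes "finite S"
  shows "inj_on (pick S) {..<card S}" "pick S ` {..<card S} = S"
proof -
  show inj: "inj_on (pick S) {..<card S}"
    by (auto intro!: inj_onI) (metis nat_neq_iff pick_mono_le)
  have "pick S ` {..<card S} \<subseteq> S"
    using pick_in_set_le by auto
  then show "pick S ` {..<card S} = S"
    using inj assms by (simp add: card_image card_subset_eq)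
qed

lemma append_enumerations:
  fixes f g :: "nat \<Rightarrow> 'b"
  assumes "inj_on f {..<k}" "inj_on g {..<l}" "f ` {..<k} \<inter> g ` {..<l} = {}"
  shows "inj_on (\<lambda>j. if j < k then f j else g (j - k)) {..<k + l}" (is "inj_on ?h _")
    and "(\<lambda>j. if j < k then f j else g (j - k)) ` {..<k + l} = f ` {..<k} \<union> g ` {..<l}"
proof -
  have fg: "f i \<noteq> g j" if "i < k" "j < l" for i j
    using assms(3) that by blast
  show "inj_on ?h {..<k + l}"
  proof (rule inj_onI)
    fix i j assume ij: "i \<in> {..<k + l}" "j \<in> {..<k + l}" and eq: "?h i = ?h j"
    have sub: "x - k < l" if "k \<le> x" "x \<in> {..<k + l}" for x
      using that unfolding lessThan_iff by linarith
    consider "i < k" "j < k" | "i < k" "k \<le> j" | "k \<le> i" "j < k" | "k \<le> i" "k \<le> j"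
      by linarith
    then show "i = j"
    proof cases
      case 1
      then show ?thesis using eq inj_onD[OF assms(1), of i j] by simp
    next
      case 2
      then show ?thesis using eq fg[of i "j - k"] sub[of j] ij by simp
    next
      case 3
      then show ?thesis using eq[symmetric] fg[of j "i - k"] sub[of i] ij by simp
    next
      case 4
      then have "i - k = j - k" using eq sub[of i] sub[of j] ij inj_onD[OF assms(2), of "i - k" "j - k"] by simp
      then show ?thesis using 4 by simp
    qed
  qed
  show "?h ` {..<k + l} = f ` {..<k} \<union> g ` {..<l}"
  proof
    show "f ` {..<k} \<union> g ` {..<l} \<subseteq> ?h ` {..<k + l}"
    proof
      fix y assume "y \<in> f ` {..<k} \<union> g ` {..<l}"
      then consider i where "i < k" "y = f i" | i where "i < l" "y = g i" by auto
      then show "y \<in> ?h ` {..<k + l}"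
      proof cases
        case 1
        then show ?thesis by (intro image_eqI[of _ _ i]) auto
      next
        case 2
        then show ?thesis by (intro image_eqI[of _ _ "k + i"]) auto
      qed
    qed
  qed auto
qed

text \<open>
  When each column lives either in the first \<open>k\<close> or in the last \<open>l\<close> rows, sorting the columns
  accordingly produces a block diagonal matrix, with square blocks if \<open>card S = k\<close>; otherwise one of
  the two kinds of columns is too numerous for its rows.
\<close>

lemma fdet_split:
  fixes f :: "nat \<Rightarrow> nat \<Rightarrow> 'a::idom"
  assumes S: "S \<subseteq> {..<k + l}"
  shows "card S \<noteq> k \<Longrightarrow> fdet (k + l) (\<lambda>i j. if (i < k) = (j \<in> S) then f i j else 0) = 0" (is "_ \<Longrightarrow> ?D = 0")
    and "card S = k \<Longrightarrow> \<exists>\<epsilon>\<in>{1, - 1}. fdet (k + l) (\<lambda>i j. if (i < k) = (j \<in> S) then f i j else 0) =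
      \<epsilon> * (fdet k (\<lambda>i j. f i (pick S j)) * fdet l (\<lambda>i j. f (k + i) (pick ({..<k + l} - S) j)))"
proof -
  let ?S' = "{..<k + l} - S"
  have fin: "finite S" using S finite_subset by auto
  have cS': "card ?S' = k + l - card S" and cS: "card S \<le> k + l"
    using S card_mono[OF _ S] by (simp_all add: card_Diff_subset fin)
  show "?D = 0" if "card S \<noteq> k"
  proof (cases "k < card S")
    case True
    then show ?thesis
      using S by (intro fdet_eq_0_pigeonhole[of S _ "{..<k}"]) auto
  next
    case False
    then have "card {k..<k + l} < card ?S'"
      using that cS' cS by simp
    then show ?thesis
      by (intro fdet_eq_0_pigeonhole[of ?S' _ "{k..<k + l}"]) auto
  qed
  assume k: "card S = k"
  define \<kappa> where "\<kappa> j = (if j < k then pick S j else pick ?S' (j - k))" for j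
  have pS: "inj_on (pick S) {..<k}" "pick S ` {..<k} = S"
    using pick_enumerates[OF fin] k by auto
  have pS': "inj_on (pick ?S') {..<l}" "pick ?S' ` {..<l} = ?S'"
    using pick_enumerates[of ?S'] k cS' by auto
  have \<kappa>1: "j < k \<Longrightarrow> \<kappa> j \<in> S" for j
    using pS unfolding \<kappa>_def by auto
  have \<kappa>2: "j < k + l \<Longrightarrow> \<not> j < k \<Longrightarrow> \<kappa> j \<in> ?S'" for j
    using pS'(2) unfolding \<kappa>_def by auto
  have inj: "inj_on \<kappa> {..<k + l}" and im: "\<kappa> ` {..<k + l} = {..<k + l}"
    using append_enumerations[OF pS(1) pS'(1)] S unfolding \<kappa>_def pS(2) pS'(2) by auto
  let ?g = "\<lambda>i j. if (i < k) = (j \<in> S) then f i j else 0"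
  have "fdet (k + l) (\<lambda>i j. ?g i (\<kappa> j)) = fdet k (\<lambda>i j. ?g i (\<kappa> j)) * fdet l (\<lambda>i j. ?g (k + i) (\<kappa> (k + j)))"
    by (rule fdet_block) (use \<kappa>1 in auto)
  also have "fdet k (\<lambda>i j. ?g i (\<kappa> j)) = fdet k (\<lambda>i j. f i (pick S j))"
    by (rule fdet_cong) (use \<kappa>1 in \<open>auto simp: \<kappa>_def\<close>)
  also have "fdet l (\<lambda>i j. ?g (k + i) (\<kappa> (k + j))) = fdet l (\<lambda>i j. f (k + i) (pick ?S' j))"
    by (rule fdet_cong) (use \<kappa>2[of "k + _"] in \<open>auto simp: \<kappa>_def\<close>)
  finally have *: "fdet (k + l) (\<lambda>i j. ?g i (\<kappa> j)) =
    fdet k (\<lambda>i j. f i (pick S j)) * fdet l (\<lambda>i j. f (k + i) (pick ?S' j))" .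
  have "fdet (k + l) ?g \<in> {fdet (k + l) (\<lambda>i j. ?g i (\<kappa> j)), - fdet (k + l) (\<lambda>i j. ?g i (\<kappa> j))}"
    using fdet_reindex[of "\<lambda>i. i" "k + l" "\<lambda>i. i" "\<lambda>j. j" \<kappa> ?g] inj im by simp
  then show "\<exists>\<epsilon>\<in>{1, - 1}. ?D =
      \<epsilon> * (fdet k (\<lambda>i j. f i (pick S j)) * fdet l (\<lambda>i j. f (k + i) (pick ?S' j)))"
    unfolding * by auto
qed

text \<open>
  Split every column into its part in the first \<open>k\<close> rows and its part in the remaining rows, and
  use that the determinant is additive in each column; \<open>S\<close> records the columns whose upper part is
  chosen.
\<close>

lemma fdet_sum_splits:
  fixes f :: "nat \<Rightarrow> nat \<Rightarrow> 'a::comm_ring_1"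
  shows "fdet N f = (\<Sum>S\<in>Pow {..<N}. fdet N (\<lambda>i j. if (i < k) = (j \<in> S) then f i j else 0))"
    (is "_ = (\<Sum>S\<in>_. fdet N (?g S))")
proof -
  have prod_split: "(\<Prod>i = 0..<N. f (p i) i) = (\<Sum>S\<in>Pow {..<N}. \<Prod>i = 0..<N. ?g S (p i) i)" for p
  proof -
    have "(\<Prod>i = 0..<N. f (p i) i) =
      (\<Prod>i\<in>{..<N}. (if p i < k then f (p i) i else 0) + (if p i < k then 0 else f (p i) i))"
      by (rule prod.cong) auto
    also have "\<dots> = (\<Sum>S\<in>Pow {..<N}. (\<Prod>i\<in>S. if p i < k then f (p i) i else 0) *
        (\<Prod>i\<in>{..<N} - S. if p i < k then 0 else f (p i) i))"
      by (rule prod_add) simp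
    also have "\<dots> = (\<Sum>S\<in>Pow {..<N}. \<Prod>i = 0..<N. ?g S (p i) i)"
    proof (rule sum.cong[OF refl])
      fix S assume S: "S \<in> Pow {..<N}"
      have "(\<Prod>i = 0..<N. ?g S (p i) i) = (\<Prod>i\<in>{..<N} - S. ?g S (p i) i) * (\<Prod>i\<in>S. ?g S (p i) i)"
        using S by (simp add: prod.subset_diff atLeast0LessThan)
      also have "(\<Prod>i\<in>{..<N} - S. ?g S (p i) i) = (\<Prod>i\<in>{..<N} - S. if p i < k then 0 else f (p i) i)"
        by (rule prod.cong) auto
      also have "(\<Prod>i\<in>S. ?g S (p i) i) = (\<Prod>i\<in>S. if p i < k then f (p i) i else 0)"
        by (rule prod.cong) auto
      finally show "(\<Prod>i\<in>S. if p i < k then f (p i) i else 0) *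
        (\<Prod>i\<in>{..<N} - S. if p i < k then 0 else f (p i) i) = (\<Prod>i = 0..<N. ?g S (p i) i)"
        by (simp add: mult.commute)
    qed
    finally show ?thesis .
  qed
  have "fdet N f = (\<Sum>p | p permutes {0..<N}. signof p * (\<Prod>i = 0..<N. f (p i) i))"
    by (rule fdet_leibniz_cols)
  also have "\<dots> = (\<Sum>S\<in>Pow {..<N}. \<Sum>p | p permutes {0..<N}. signof p * (\<Prod>i = 0..<N. ?g S (p i) i))"
    unfolding prod_split sum_distrib_left by (rule sum.swap)
  also have "\<dots> = (\<Sum>S\<in>Pow {..<N}. fdet N (?g S))"
    by (intro sum.cong refl fdet_leibniz_cols[symmetric])
  finally show ?thesis .
qed

text \<open>
  Laplace expansion along the first \<open>k\<close> rows, with signs left unspecified.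
\<close>

theorem generalized_laplace:
  fixes f :: "nat \<Rightarrow> nat \<Rightarrow> 'a::idom"
  shows "\<exists>\<epsilon>. range \<epsilon> \<subseteq> {1, - 1} \<and> fdet (k + l) f = (\<Sum>S | S \<subseteq> {..<k + l} \<and> card S = k.
    \<epsilon> S * (fdet k (\<lambda>i j. f i (pick S j)) * fdet l (\<lambda>i j. f (k + i) (pick ({..<k + l} - S) j))))"
proof -
  let ?g = "\<lambda>S i j. if (i < k) = (j \<in> S) then f i j else 0"
  let ?P = "\<lambda>S. fdet k (\<lambda>i j. f i (pick S j)) * fdet l (\<lambda>i j. f (k + i) (pick ({..<k + l} - S) j))"
  have "\<forall>S. \<exists>e. e \<in> {1, - 1} \<and> (S \<subseteq> {..<k + l} \<and> card S = k \<longrightarrow> fdet (k + l) (?g S) = e * ?P S)"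
    using fdet_split(2)[of _ k l f] by blast
  from choice[OF this] obtain \<epsilon> where \<epsilon>: "\<And>S. \<epsilon> S \<in> {1, - 1}"
    "\<And>S. S \<subseteq> {..<k + l} \<Longrightarrow> card S = k \<Longrightarrow> fdet (k + l) (?g S) = \<epsilon> S * ?P S"
    by blast
  have "fdet (k + l) f = (\<Sum>S\<in>Pow {..<k + l}. fdet (k + l) (?g S))"
    by (rule fdet_sum_splits)
  also have "\<dots> = (\<Sum>S | S \<subseteq> {..<k + l} \<and> card S = k. fdet (k + l) (?g S))"
    by (rule sum.mono_neutral_right) (auto intro!: fdet_split(1))
  also have "\<dots> = (\<Sum>S | S \<subseteq> {..<k + l} \<and> card S = k. \<epsilon> S * ?P S)"
    by (rule sum.cong[OF refl], rule \<epsilon>(2)) simp_all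
  finally show ?thesis
    using \<epsilon>(1) by blast
qed

lemma fdet_expand_col:
  assumes j0: "j0 < m"
  shows "fdet m f = (\<Sum>i<m. f i j0 * fdet m (\<lambda>k l. if l = j0 then (if k = i then 1 else 0) else f k l))"
proof -
  let ?M = "mat m m (\<lambda>(i, j). f i j)"
  have "fdet m f = (\<Sum>i<m. ?M $$ (i, j0) * cofactor ?M i j0)"
    by (rule laplace_expansion_column) (use j0 in auto)
  also have "\<dots> = (\<Sum>i<m. f i j0 * fdet m (\<lambda>k l. if l = j0 then (if k = i then 1 else 0) else f k l))"
  proof (intro sum.cong refl)
    fix i assume "i \<in> {..<m}"
    then have i: "i < m" by simp
    let ?N = "mat m m (\<lambda>(k, l). if l = j0 then (if k = i then 1 else 0) else f k l)"
    have "det ?N = (\<Sum>k<m. ?N $$ (k, j0) * cofactor ?N k j0)"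
      by (rule laplace_expansion_column) (use j0 in auto)
    also have "\<dots> = (\<Sum>k<m. if k = i then cofactor ?N i j0 else 0)"
      using j0 by (intro sum.cong) auto
    also have "\<dots> = cofactor ?N i j0"
      using i by simp
    also have "mat_delete ?N i j0 = mat_delete ?M i j0"
      by (rule eq_matI) (auto simp: mat_delete_def)
    then have "cofactor ?N i j0 = cofactor ?M i j0"
      by (simp add: cofactor_def)
    finally show "?M $$ (i, j0) * cofactor ?M i j0 = f i j0 * det ?N"
      using i j0 by simp
  qed
  finally show ?thesis .
qed

section \<open>Exchanging columns between two brackets\<close>

definition bracket :: "nat \<Rightarrow> (nat \<Rightarrow> nat \<Rightarrow> 'a) \<Rightarrow> nat set \<Rightarrow> 'a::comm_ring_1" where
  "bracket m Y C = fdet m (\<lambda>i j. Y i (pick C j))"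

lemma fdet_cols_bracket:
  assumes "finite S" "card S = m"
  shows "inj_on c S \<Longrightarrow> fdet m (\<lambda>i j. Y i (c (pick S j))) \<in> {bracket m Y (c ` S), - bracket m Y (c ` S)}"
    and "\<not> inj_on c S \<Longrightarrow> fdet m (\<lambda>i j. Y i (c (pick S j))) = 0"
proof -
  have pS: "inj_on (pick S) {..<m}" "pick S ` {..<m} = S"
    using pick_enumerates[OF assms(1)] assms(2) by auto
  show "fdet m (\<lambda>i j. Y i (c (pick S j))) \<in> {bracket m Y (c ` S), - bracket m Y (c ` S)}" if inj: "inj_on c S"
  proof -
    have pc: "inj_on (pick (c ` S)) {..<m}" "pick (c ` S) ` {..<m} = c ` S"
      using pick_enumerates[of "c ` S"] assms inj by (auto simp: card_image)
    have "inj_on (\<lambda>j. c (pick S j)) {..<m}"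
      using comp_inj_on[OF pS(1), of c] inj pS(2) by (simp add: comp_def)
    moreover have "(\<lambda>j. c (pick S j)) ` {..<m} = c ` S"
      using pS(2) by (metis image_image)
    ultimately show ?thesis
      unfolding bracket_def
      using fdet_reindex[of "\<lambda>i. i" m "\<lambda>i. i" "\<lambda>j. c (pick S j)" "pick (c ` S)" Y] pc by simp
  qed
  show "fdet m (\<lambda>i j. Y i (c (pick S j))) = 0" if ninj: "\<not> inj_on c S"
  proof -
    obtain a b where ab: "a \<in> S" "b \<in> S" "a \<noteq> b" "c a = c b"
      using ninj by (auto simp: inj_on_def)
    obtain i where i: "i < m" "pick S i = a"
      using ab(1) pS(2) by (metis image_iff lessThan_iff)
    obtain j where j: "j < m" "pick S j = b"
      using ab(2) pS(2) by (metis image_iff lessThan_iff)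
    show ?thesis
      by (rule fdet_identical_cols[of i j]) (use ab i j in auto)
  qed
qed

text \<open>
  Subtracting the upper half of the matrix from the lower half leaves more than \<open>m\<close> columns with
  support in only \<open>m\<close> rows.
\<close>

lemma fdet_repeated_blocks:
  fixes f :: "nat \<Rightarrow> nat \<Rightarrow> 'a::comm_ring_1"
  assumes K: "K \<subseteq> {..<m + m}" "m < card K"
    and eq: "\<And>i j. i < m \<Longrightarrow> j \<in> K \<Longrightarrow> f (m + i) j = f i j"
  shows "fdet (m + m) f = 0"
proof -
  let ?g = "\<lambda>i j. if i < m then f i j else f i j - f (i - m) j"
  let ?l = "\<lambda>i j. if i = j then 1 else if i = j + m then - 1 else 0"
  let ?L = "mat (m + m) (m + m) (\<lambda>(i, j). ?l i j) :: 'a mat"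
  let ?F = "mat (m + m) (m + m) (\<lambda>(i, j). f i j)"
  have "?L * ?F = mat (m + m) (m + m) (\<lambda>(i, j). ?g i j)"
  proof (rule eq_matI)
    fix i j assume "i < dim_row (mat (m + m) (m + m) (\<lambda>(i, j). ?g i j))"
      "j < dim_col (mat (m + m) (m + m) (\<lambda>(i, j). ?g i j))"
    then have ij: "i < m + m" "j < m + m" by simp_all
    have "(\<Sum>k = 0..<m + m. ?l i k * f k j) =
      (\<Sum>k = 0..<m + m. (if k = i then f k j else 0) + (if m \<le> i \<and> k = i - m then - f k j else 0))"
      using ij by (intro sum.cong) auto
    also have "\<dots> = f i j + (if m \<le> i then - f (i - m) j else 0)"
      using ij by (subst sum.distrib) (auto simp: sum.delta)
    finally show "(?L * ?F) $$ (i, j) = mat (m + m) (m + m) (\<lambda>(i, j). ?g i j) $$ (i, j)"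
      using ij by (simp add: scalar_prod_def)
  qed simp_all
  then have "fdet (m + m) ?g = det ?L * fdet (m + m) f"
    using det_mult[of ?L "m + m" ?F] by simp
  moreover have "det ?L = 1"
  proof -
    have "diag_mat ?L = replicate (m + m) 1"
      by (intro nth_equalityI) (auto simp: diag_mat_def)
    then show ?thesis
      by (subst det_lower_triangular[where n = "m + m"]) (auto simp: prod_list_replicate)
  qed
  moreover have "fdet (m + m) ?g = 0"
  proof (rule fdet_eq_0_pigeonhole[OF K(1), of "{..<m}"])
    show "?g i j = 0" if "i < m + m" "i \<notin> {..<m}" "j \<in> K" for i j
      using eq[of "i - m" j] that by auto
  qed (use K in auto)
  ultimately show ?thesis by simp
qed

text \<open>
  This is the quadratic relation behind straightening. Consider the matrix

  \<open>( C_low  C_high  D_low  0      )\<close>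

  \<open>( 0      C_high  D_low  D_high )\<close>

  in which \<open>low\<close> and \<open>high\<close> select the columns below \<open>x\<close> and from \<open>x\<close> on. The two middle blocks have
  more than \<open>m\<close> columns, so its determinant is zero. Laplace expansion along the upper half gives a
  vanishing signed sum of products of two brackets; one summand is the product for \<open>C\<close> and \<open>D\<close>, and
  each other one that does not vanish arises by trading some columns of \<open>C\<close> from \<open>x\<close> on for columns
  of \<open>D\<close> below \<open>x\<close>. A
  set \<open>V\<close> closed under addition and negation takes the place of the explicit sum, which makes the
  signs irrelevant.
\<close>

theorem exchange:
  fixes Y :: "nat \<Rightarrow> nat \<Rightarrow> 'a::idom"
  assumes C: "finite C" "card C = m" and D: "finite D" "card D = m"
    and less: "card (C \<inter> {..<x}) < card (D \<inter> {..<x})"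
    and V: "0 \<in> V" "\<And>u v. u \<in> V \<Longrightarrow> v \<in> V \<Longrightarrow> u + v \<in> V" "\<And>u. u \<in> V \<Longrightarrow> - u \<in> V"
    and step: "\<And>C' D'. C' \<subseteq> C \<union> D \<Longrightarrow> card C' = m \<Longrightarrow> D' \<subseteq> C \<union> D \<Longrightarrow> card D' = m \<Longrightarrow>
      C' - C \<subseteq> {..<x} \<Longrightarrow> C - C' \<subseteq> {x..} \<Longrightarrow> C' \<noteq> C \<Longrightarrow> bracket m Y C' * bracket m Y D' \<in> V"
  shows "bracket m Y C * bracket m Y D \<in> V"
proof -
  define U where "U = (C \<inter> {x..}) \<union> (D \<inter> {..<x})"
  define \<Lambda> where "\<Lambda> = {0} \<times> (C \<inter> {..<x}) \<union> {1} \<times> U \<union> {2 :: nat} \<times> (D \<inter> {x..})"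
  have split: "card (E \<inter> {..<x}) + card (E \<inter> {x..}) = card E" if "finite E" for E :: "nat set"
    using that by (subst card_Un_disjoint[symmetric]) (auto intro: arg_cong[of _ _ card])
  have cU: "card U = card (C \<inter> {x..}) + card (D \<inter> {..<x})"
    unfolding U_def using C(1) D(1) by (intro card_Un_disjoint) auto
  have fin: "finite \<Lambda>"
    unfolding \<Lambda>_def U_def using C(1) D(1) by auto
  have "card \<Lambda> = card (C \<inter> {..<x}) + card U + card (D \<inter> {x..})"
    unfolding \<Lambda>_def using C(1) D(1)
    by (subst card_Un_disjoint, (auto simp: U_def)[3])+ (simp add: card_cartesian_product)
  then have c\<Lambda>: "card \<Lambda> = m + m"
    using split[OF C(1)] split[OF D(1)] cU C(2) D(2) by simp
  obtain h where h: "bij_betw h {..<m + m} \<Lambda>"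
    using ex_bij_betw_nat_finite[OF fin] c\<Lambda> by (auto simp: atLeast0LessThan)
  \<comment> \<open>The columns of the block matrix are labelled by their block: 0 for \<open>C_low\<close>, 1 for the two
    middle blocks, 2 for \<open>D_high\<close>.\<close>
  define lab where "lab j = fst (h j)" for j
  define c where "c j = snd (h j)" for j
  have lc: "(lab j = 0 \<and> c j \<in> C \<inter> {..<x}) \<or> (lab j = 1 \<and> c j \<in> U) \<or> (lab j = 2 \<and> c j \<in> D \<inter> {x..})"
    if "j < m + m" for j
    using bij_betwE[OF h, rule_format, of j] that by (auto simp: \<Lambda>_def lab_def c_def)
  have ex: "\<exists>j<m + m. lab j = k \<and> c j = y" if "(k, y) \<in> \<Lambda>" for k y
    using h that unfolding bij_betw_def lab_def c_def by (metis fst_conv imageE lessThan_iff snd_conv)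
  have uniq: "i = j" if "i < m + m" "j < m + m" "lab i = lab j" "c i = c j" for i j
    using h that unfolding bij_betw_def lab_def c_def
    by (metis inj_onD lessThan_iff prod.collapse)
  let ?f = "\<lambda>i j. if i < m then (if lab j = 2 then 0 else Y i (c j))
    else (if lab j = 0 then 0 else Y (i - m) (c j))"
  let ?all = "{..<m + m}"
  let ?P = "\<lambda>S. fdet m (\<lambda>i j. ?f i (pick S j)) * fdet m (\<lambda>i j. ?f (m + i) (pick (?all - S) j))"
  let ?\<S> = "{S. S \<subseteq> ?all \<and> card S = m}"
  \<comment> \<open>The choice of columns for the upper half whose summand is the given product.\<close>
  define S0 where "S0 = {j\<in>?all. lab j = 0 \<or> lab j = 1 \<and> x \<le> c j}"

  have zero: "fdet (m + m) ?f = 0"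
  proof (rule fdet_repeated_blocks)
    let ?K = "{j\<in>?all. lab j = 1}"
    have "U \<subseteq> c ` ?K"
    proof
      fix y assume "y \<in> U"
      then show "y \<in> c ` ?K" using ex[of 1 y] by (auto simp: \<Lambda>_def)
    qed
    then have "card U \<le> card ?K"
      by (intro surj_card_le) simp_all
    moreover have "m < card U"
      using split[OF C(1)] cU C(2) less by simp
    ultimately show "m < card ?K" by simp
  qed auto

  have top: "fdet m (\<lambda>i j. ?f i (pick S j)) = fdet m (\<lambda>i j. Y i (c (pick S j)))"
    if "S \<subseteq> ?all" "card S = m" "\<And>j. j \<in> S \<Longrightarrow> lab j \<noteq> 2" for S
  proof (rule fdet_cong)
    fix i j assume "i < m" "j < m"
    then have "pick S j \<in> S" using that pick_in_set_le by auto
    then show "?f i (pick S j) = Y i (c (pick S j))" using that(3) \<open>i < m\<close> by auto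
  qed
  have bot: "fdet m (\<lambda>i j. ?f (m + i) (pick S j)) = fdet m (\<lambda>i j. Y i (c (pick S j)))"
    if "S \<subseteq> ?all" "card S = m" "\<And>j. j \<in> S \<Longrightarrow> lab j \<noteq> 0" for S
  proof (rule fdet_cong)
    fix i j assume "i < m" "j < m"
    then have "pick S j \<in> S" using that pick_in_set_le by auto
    then show "?f (m + i) (pick S j) = Y i (c (pick S j))" using that(3)[of "pick S j"] by simp
  qed
  have zero_col: "fdet m (\<lambda>i j. F i (pick S j)) = 0"
    if zc: "S \<subseteq> ?all" "card S = m" "s \<in> S" "\<And>i. i < m \<Longrightarrow> F i s = 0" for S s and F :: "nat \<Rightarrow> nat \<Rightarrow> 'a"
  proof -
    have "finite S" using zc(1) finite_subset by auto
    then obtain k where "k < m" "pick S k = s"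
      using pick_enumerates(2)[of S] zc(2,3) by (metis image_iff lessThan_iff)
    then show ?thesis
      by (intro fdet_eq_0_pigeonhole[of "{k}" _ "{}"]) (use zc in auto)
  qed

  have S0: "S0 \<subseteq> ?all" by (auto simp: S0_def)
  have fS0: "finite S0" using S0 finite_subset by auto
  have inj0: "inj_on c S0"
  proof (rule inj_onI)
    fix i j assume "i \<in> S0" "j \<in> S0" "c i = c j"
    then show "i = j"
      using lc[of i] lc[of j] uniq[of i j] by (auto simp: S0_def)
  qed
  have im0: "c ` S0 = C"
  proof
    show "c ` S0 \<subseteq> C" using lc by (fastforce simp: S0_def U_def)
    show "C \<subseteq> c ` S0"
    proof
      fix y assume y: "y \<in> C"
      then obtain j where "j < m + m" "lab j = (if y < x then 0 else 1)" "c j = y"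
        using ex[of 0 y] ex[of 1 y] by (cases "y < x") (auto simp: \<Lambda>_def U_def)
      then show "y \<in> c ` S0" by (auto simp: S0_def split: if_splits)
    qed
  qed
  have inj1: "inj_on c (?all - S0)"
  proof (rule inj_onI)
    fix i j assume "i \<in> ?all - S0" "j \<in> ?all - S0" "c i = c j"
    then show "i = j"
      using lc[of i] lc[of j] uniq[of i j] by (auto simp: S0_def)
  qed
  have im1: "c ` (?all - S0) = D"
  proof
    show "c ` (?all - S0) \<subseteq> D" using lc by (fastforce simp: S0_def U_def)
    show "D \<subseteq> c ` (?all - S0)"
    proof
      fix y assume y: "y \<in> D"
      then obtain j where "j < m + m" "lab j = (if y < x then 1 else 2)" "c j = y"
        using ex[of 1 y] ex[of 2 y] by (cases "y < x") (auto simp: \<Lambda>_def U_def)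
      then show "y \<in> c ` (?all - S0)" by (auto simp: S0_def split: if_splits)
    qed
  qed
  have cS0: "card S0 = m" using card_image[OF inj0] im0 C(2) by simp
  have P0: "?P S0 = bracket m Y C * bracket m Y D \<or> ?P S0 = - (bracket m Y C * bracket m Y D)"
  proof -
    have c1: "card (?all - S0) = m" using card_image[OF inj1] im1 D(2) by simp
    have "lab j \<noteq> 2" if "j \<in> S0" for j using that by (auto simp: S0_def)
    then have "fdet m (\<lambda>i j. ?f i (pick S0 j)) \<in> {bracket m Y C, - bracket m Y C}"
      using top[OF S0 cS0] fdet_cols_bracket(1)[OF fS0 cS0 inj0, of Y] im0 by simp
    moreover have "lab j \<noteq> 0" if "j \<in> ?all - S0" for j using that by (auto simp: S0_def)
    then have "fdet m (\<lambda>i j. ?f (m + i) (pick (?all - S0) j)) \<in> {bracket m Y D, - bracket m Y D}"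
      using bot[OF _ c1] fdet_cols_bracket(1)[OF _ c1 inj1, of Y] im1 by simp
    ultimately show ?thesis by auto
  qed

  have P: "?P S \<in> V" if S: "S \<subseteq> ?all" "card S = m" "S \<noteq> S0" for S
  proof -
    have fS: "finite S" using S(1) finite_subset by auto
    have cS': "card (?all - S) = m" using S by (simp add: card_Diff_subset fS)
    \<comment> \<open>An upper bracket using a column of \<open>D_high\<close>, or a lower one using a column of \<open>C_low\<close>, has a
      zero column; repeated columns give zero as well.\<close>
    consider (two) j where "j \<in> S" "lab j = 2" | (zero) j where "j \<in> ?all - S" "lab j = 0"
      | (ninj) "\<not> inj_on c S" "\<forall>j\<in>S. lab j \<noteq> 2"
      | (ninj') "\<not> inj_on c (?all - S)" "\<forall>j\<in>?all - S. lab j \<noteq> 0"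
      | (inj) "inj_on c S" "inj_on c (?all - S)" "\<forall>j\<in>S. lab j \<noteq> 2" "\<forall>j\<in>?all - S. lab j \<noteq> 0"
      by blast
    then show ?thesis
    proof cases
      case two
      then show ?thesis using zero_col[OF S(1,2), of j ?f] V(1) by simp
    next
      case zero
      then show ?thesis using zero_col[OF _ cS', of j "\<lambda>i. ?f (m + i)"] V(1) by simp
    next
      case ninj
      then show ?thesis using top[OF S(1,2)] fdet_cols_bracket(2)[OF fS S(2), of c Y] V(1) by simp
    next
      case ninj'
      then show ?thesis using bot[OF _ cS'] fdet_cols_bracket(2)[OF _ cS', of c Y] V(1) by simp
    next
      case inj
      have memS: "j \<in> S" if "lab j = 0" "j < m + m" for j
        using inj(4) that by (metis DiffI lessThan_iff)
      let ?C = "c ` S" and ?D = "c ` (?all - S)"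
      have sub: "?C \<subseteq> C \<union> D" "?D \<subseteq> C \<union> D" using lc S(1) by (fastforce simp: U_def)+
      have "?C - C \<subseteq> {..<x}" using lc S(1) inj(3) by (fastforce simp: U_def)
      moreover have "C - ?C \<subseteq> {x..}"
      proof
        fix y assume y: "y \<in> C - ?C"
        show "y \<in> {x..}"
        proof (rule ccontr)
          assume "y \<notin> {x..}"
          then obtain j where "j < m + m" "lab j = 0" "c j = y"
            using ex[of 0 y] y by (auto simp: \<Lambda>_def)
          moreover from this have "j \<in> S" using memS by auto
          ultimately show False using y by auto
        qed
      qed
      moreover have "?C \<noteq> C"
      proof
        assume eq: "?C = C"
        have "S0 \<subseteq> S"
        proof
          fix j assume j: "j \<in> S0"
          show "j \<in> S"
          proof (cases "lab j = 0")
            case True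
            then show ?thesis using memS j by (auto simp: S0_def)
          next
            case False
            then have l1: "lab j = 1" "x \<le> c j" "j < m + m" using j by (auto simp: S0_def)
            then have "c j \<in> C" using im0 j by auto
            then obtain i where i: "i \<in> S" "c i = c j" using eq by auto
            then have "lab i = 1" using lc[of i] l1 inj(3) S(1) by fastforce
            then have "i = j" using uniq[of i j] i l1 S(1) by auto
            then show ?thesis using i by simp
          qed
        qed
        then show False using S(2,3) cS0 fS card_subset_eq by metis
      qed
      ultimately have "bracket m Y ?C * bracket m Y ?D \<in> V"
        using step[OF sub(1) _ sub(2)] card_image[OF inj(1)] card_image[OF inj(2)] S(2) cS' by simp
      moreover have "fdet m (\<lambda>i j. ?f i (pick S j)) \<in> {bracket m Y ?C, - bracket m Y ?C}"
        using top[OF S(1,2)] fdet_cols_bracket(1)[OF fS S(2) inj(1), of Y] inj(3) by simp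
      moreover have "fdet m (\<lambda>i j. ?f (m + i) (pick (?all - S) j)) \<in> {bracket m Y ?D, - bracket m Y ?D}"
        using bot[OF _ cS'] fdet_cols_bracket(1)[OF _ cS' inj(2), of Y] inj(4) by simp
      ultimately show ?thesis using V(3) by auto
    qed
  qed

  obtain \<epsilon> where \<epsilon>: "range \<epsilon> \<subseteq> {1, - 1}" and sum: "0 = (\<Sum>S\<in>?\<S>. \<epsilon> S * ?P S)"
    using generalized_laplace[of m m ?f] zero by auto
  have sumV: "sum g A \<in> V" if "\<And>a. a \<in> A \<Longrightarrow> g a \<in> V" for g and A :: "nat set set"
    using that by (induction A rule: infinite_finite_induct) (auto intro: V)
  have signV: "\<epsilon> S * u \<in> V \<longleftrightarrow> u \<in> V" for S u
  proof -
    have "\<epsilon> S = 1 \<or> \<epsilon> S = - 1" using \<epsilon> by blast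
    then show ?thesis using V(3)[of u] V(3)[of "- u"] by auto
  qed
  have "finite ?\<S>" by simp
  then have "\<epsilon> S0 * ?P S0 = - (\<Sum>S\<in>?\<S> - {S0}. \<epsilon> S * ?P S)"
    using sum sum.remove[of ?\<S> S0 "\<lambda>S. \<epsilon> S * ?P S"] S0 cS0 by (simp add: eq_neg_iff_add_eq_0)
  also have "\<dots> \<in> V"
    by (rule V(3), rule sumV) (use signV P in auto)
  finally have "?P S0 \<in> V" using signV by simp
  then show ?thesis
    using P0 V(3)[of "?P S0"] by auto
qed

section \<open>Straightening\<close>

text \<open>
  Equivalent to the entrywise order of the increasing enumerations of \<open>C\<close> and \<open>D\<close> when both have
  the same size; in the counting form it is evident that conditions of the shape
  \<open>t \<le> card (C \<inter> {..<x})\<close> pass to predecessors.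
\<close>

definition col_le :: "nat set \<Rightarrow> nat set \<Rightarrow> bool" where
  "col_le C D \<longleftrightarrow> (\<forall>x. card (D \<inter> {..<x}) \<le> card (C \<inter> {..<x}))"

lemma col_le_refl [simp]: "col_le C C"
  by (simp add: col_le_def)

lemma col_le_trans: "col_le C D \<Longrightarrow> col_le D E \<Longrightarrow> col_le C E"
  unfolding col_le_def using order_trans by blast

lemma transp_col_le: "transp col_le"
  by (rule transpI) (rule col_le_trans)

lemma card_Int_lessThan_add: "finite E \<Longrightarrow> card (E \<inter> {..<x}) + card (E \<inter> {x..}) = card E" for E :: "nat set"
  by (subst card_Un_disjoint[symmetric]) (auto intro: arg_cong[of _ _ card])

text \<open>
  The sum of the columns serves as the measure that makes straightening terminate.
\<close>

lemma move_below:
  fixes C C' :: "nat set"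
  assumes fin: "finite C" "finite C'" and card: "card C' = card C"
    and new: "C' - C \<subseteq> {..<x}" and old: "C - C' \<subseteq> {x..}" and ne: "C' \<noteq> C"
  shows "\<Sum>C' < \<Sum>C" and "col_le C' C"
proof -
  have diff: "card (C' - C) = card (C - C')"
    using card card_Diff_subset_Int[of C' C] card_Diff_subset_Int[of C C'] fin
    by (simp add: Int_commute)
  have "C' - C \<noteq> {}"
    using card ne fin by (metis Diff_eq_empty_iff card_subset_eq)
  then have pos: "0 < card (C' - C)"
    using fin by (simp add: card_gt_0_iff)
  have "\<Sum>(C' - C) < card (C' - C) * x"
    using sum_bounded_above_strict[of "C' - C" "\<lambda>c. c" x] new pos by auto
  also have "\<dots> \<le> \<Sum>(C - C')"
    using sum_bounded_below[of "C - C'" x "\<lambda>c. c"] old diff by auto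
  finally have "\<Sum>(C' - C) < \<Sum>(C - C')" .
  moreover have "\<Sum>C' = \<Sum>(C \<inter> C') + \<Sum>(C' - C)"
    using sum.Int_Diff[of C' "\<lambda>c. c" C] fin by (simp add: Int_commute)
  moreover have "\<Sum>C = \<Sum>(C \<inter> C') + \<Sum>(C - C')"
    using sum.Int_Diff[of C "\<lambda>c. c" C'] fin by simp
  ultimately show "\<Sum>C' < \<Sum>C" by simp
  show "col_le C' C"
    unfolding col_le_def
  proof
    fix y
    show "card (C \<inter> {..<y}) \<le> card (C' \<inter> {..<y})"
    proof (cases "y \<le> x")
      case True
      then show ?thesis
        using old fin by (intro card_mono) force+
    next
      case False
      then have "card (C' \<inter> {y..}) \<le> card (C \<inter> {y..})"
        using new fin by (intro card_mono) force+
      then show ?thesis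
        using card_Int_lessThan_add[OF fin(1), of y] card_Int_lessThan_add[OF fin(2), of y] card by simp
    qed
  qed
qed

interpretation kspan: vector_space "\<lambda>(c::'k::field) (p::'k var_poly). Poly_Mapping.single 0 c * p"
  by unfold_locales
    (simp_all add: algebra_simps single_add mult_single flip: mult.assoc)

definition col_sets :: "nat \<Rightarrow> nat \<Rightarrow> nat set set" where
  "col_sets m N = {C. C \<subseteq> {..<N} \<and> card C = m}"

definition bracket_prod :: "nat \<Rightarrow> (nat \<Rightarrow> nat \<Rightarrow> 'a) \<Rightarrow> nat set list \<Rightarrow> 'a::comm_ring_1" where
  "bracket_prod m Y L = prod_list (map (bracket m Y) L)"

lemma bracket_prod_simps [simp]:
  "bracket_prod m Y [] = 1"
  "bracket_prod m Y (C # L) = bracket m Y C * bracket_prod m Y L"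
  "bracket_prod m Y (K @ L) = bracket_prod m Y K * bracket_prod m Y L"
  by (simp_all add: bracket_prod_def)

lemma not_sorted_wrt_adjacent:
  assumes "transp R" "\<not> sorted_wrt R L"
  obtains P C D Q where "L = P @ C # D # Q" "\<not> R C D"
proof -
  obtain i where i: "Suc i < length L" "\<not> R (L ! i) (L ! Suc i)"
    using assms sorted_wrt_iff_nth_Suc_transp by blast
  then have "L = take i L @ L ! i # L ! Suc i # drop (Suc (Suc i)) L"
    by (metis Cons_nth_drop_Suc Suc_lessD append_take_drop_id)
  then show ?thesis using that i(2) by blast
qed

text \<open>
  At an adjacent pair that is out of order apply lemma \<open>exchange\<close>: in every new product the left
  member of the pair has moved down in the order, so that the list of column sums decreases
  lexicographically, and the first factor of the whole product can only move down.
\<close>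

theorem straightening:
  fixes Y :: "nat \<Rightarrow> nat \<Rightarrow> 'k::field var_poly"
  assumes "set L \<subseteq> col_sets m N" "L \<noteq> []"
  shows "bracket_prod m Y L \<in> kspan.span (bracket_prod m Y `
    {L'. L' \<noteq> [] \<and> set L' \<subseteq> col_sets m N \<and> sorted_wrt col_le L' \<and> col_le (hd L') (hd L)})"
    (is "_ \<in> kspan.span (_ ` ?Std L)")
  using assms
proof (induction L rule: wf_induct_rule[OF wf_inv_image[OF wf_lex[OF wf_less_than], of "map (\<lambda>C. \<Sum>C)"]])
  case (1 L)
  show ?case
  proof (cases "sorted_wrt col_le L")
    case True
    then show ?thesis
      using "1.prems" by (intro kspan.span_base imageI) simp
  next
    case False
    then obtain P C D Q where L: "L = P @ C # D # Q" and "\<not> col_le C D"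
      using not_sorted_wrt_adjacent[OF transp_col_le] by metis
    then obtain x where x: "card (C \<inter> {..<x}) < card (D \<inter> {..<x})"
      by (auto simp: col_le_def not_le)
    have CD: "C \<subseteq> {..<N}" "card C = m" "D \<subseteq> {..<N}" "card D = m"
      using "1.prems" L by (auto simp: col_sets_def)
    have fin: "finite E" if "E \<subseteq> C \<union> D" for E
      using that CD(1,3) by (meson finite_UnI finite_lessThan finite_subset)
    let ?W = "kspan.span (bracket_prod m Y ` ?Std L)"
    define V where "V = {v. bracket_prod m Y P * v * bracket_prod m Y Q \<in> ?W}"
    have "bracket m Y C * bracket m Y D \<in> V"
    proof (rule exchange[of C m D x])
      show "0 \<in> V" by (simp add: V_def kspan.span_zero)
      show "u + v \<in> V" if "u \<in> V" "v \<in> V" for u v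
        using kspan.span_add[of "bracket_prod m Y P * u * bracket_prod m Y Q" _ "bracket_prod m Y P * v * bracket_prod m Y Q"] that
        by (simp add: V_def algebra_simps)
      show "- u \<in> V" if "u \<in> V" for u
        using kspan.span_neg[of "bracket_prod m Y P * u * bracket_prod m Y Q"] that by (simp add: V_def)
      fix C' D'
      assume CD': "C' \<subseteq> C \<union> D" "card C' = m" "D' \<subseteq> C \<union> D" "card D' = m"
        and mv: "C' - C \<subseteq> {..<x}" "C - C' \<subseteq> {x..}" "C' \<noteq> C"
      let ?L = "P @ C' # D' # Q"
      have less: "\<Sum>C' < \<Sum>C" "col_le C' C"
        using move_below[OF fin fin _ mv] CD' CD by auto
      have "(?L, L) \<in> inv_image (lex less_than) (map (\<lambda>C. \<Sum>C))"
        using less(1) by (auto simp: L lex_conv)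
      moreover have "C' \<in> col_sets m N" "D' \<in> col_sets m N"
        using CD CD' by (auto simp: col_sets_def)
      then have "set ?L \<subseteq> col_sets m N" using "1.prems" L by auto
      ultimately have "bracket_prod m Y ?L \<in> kspan.span (bracket_prod m Y ` ?Std ?L)"
        by (rule "1.IH") simp
      moreover have "col_le (hd ?L) (hd L)"
        using less(2) by (cases P) (auto simp: L)
      then have "?Std ?L \<subseteq> ?Std L"
        using col_le_trans by blast
      then have "kspan.span (bracket_prod m Y ` ?Std ?L) \<subseteq> ?W"
        by (intro kspan.span_mono image_mono)
      ultimately show "bracket m Y C' * bracket m Y D' \<in> V"
        by (auto simp: V_def mult.assoc)
    qed (use x CD fin in auto)
    then show ?thesis by (simp add: V_def L mult.assoc)
  qed
qed

section \<open>Lowest terms and substitution in polynomials\<close>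

definition weight :: "('v \<Rightarrow> nat) \<Rightarrow> ('v \<Rightarrow>\<^sub>0 nat) \<Rightarrow> nat" where
  "weight w \<mu> = (\<Sum>v\<in>Poly_Mapping.keys \<mu>. w v * Poly_Mapping.lookup \<mu> v)"

lemma weight_superset:
  assumes "finite A" "Poly_Mapping.keys \<mu> \<subseteq> A"
  shows "weight w \<mu> = (\<Sum>v\<in>A. w v * Poly_Mapping.lookup \<mu> v)"
  unfolding weight_def using assms by (intro sum.mono_neutral_left) (auto simp: in_keys_iff)

lemma weight_zero [simp]: "weight w 0 = 0"
  by (simp add: weight_def)

lemma weight_single [simp]: "weight w (Poly_Mapping.single v k) = w v * k"
  by (subst weight_superset[of "{v}"]) auto

lemma weight_add: "weight w (\<mu> + \<nu>) = weight w \<mu> + weight w \<nu>"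
proof -
  let ?A = "Poly_Mapping.keys \<mu> \<union> Poly_Mapping.keys \<nu>"
  show ?thesis
    using Poly_Mapping.keys_add[of \<mu> \<nu>]
    by (subst (1 2 3) weight_superset[of ?A]) (auto simp: lookup_add algebra_simps sum.distrib)
qed

lemma weight_sum: "weight w (sum f A) = (\<Sum>a\<in>A. weight w (f a))"
  by (induction A rule: infinite_finite_induct) (simp_all add: weight_add)

text \<open>
  A weight instead of a monomial order suffices, because the diagonal product of a minor is its only
  term of least weight.
\<close>

definition lowest_term :: "('v \<Rightarrow> nat) \<Rightarrow> ('v \<Rightarrow>\<^sub>0 nat) \<Rightarrow> (('v \<Rightarrow>\<^sub>0 nat) \<Rightarrow>\<^sub>0 'a::comm_ring_1) \<Rightarrow> bool" where
  "lowest_term w \<mu> p \<longleftrightarrow> (\<forall>\<kappa>\<in>Poly_Mapping.keys (p - Poly_Mapping.single \<mu> 1). weight w \<mu> < weight w \<kappa>)"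

lemma lowest_term_one: "lowest_term w 0 1"
  by (simp add: lowest_term_def)

lemma lowest_term_mult:
  assumes "lowest_term w \<mu> p" "lowest_term w \<nu> q"
  shows "lowest_term w (\<mu> + \<nu>) (p * q)"
  unfolding lowest_term_def
proof
  let ?s = "\<lambda>\<mu>. Poly_Mapping.single \<mu> 1"
  let ?p = "p - ?s \<mu>" and ?q = "q - ?s \<nu>"
  fix \<kappa> assume "\<kappa> \<in> Poly_Mapping.keys (p * q - ?s (\<mu> + \<nu>))"
  moreover have "p * q - ?s (\<mu> + \<nu>) = ?s \<mu> * ?q + (?p * ?s \<nu> + ?p * ?q)"
    by (simp add: algebra_simps mult_single)
  ultimately have "\<kappa> \<in> Poly_Mapping.keys (?s \<mu> * ?q) \<union> (Poly_Mapping.keys (?p * ?s \<nu>) \<union> Poly_Mapping.keys (?p * ?q))"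
    using Poly_Mapping.keys_add[of "?s \<mu> * ?q" "?p * ?s \<nu> + ?p * ?q"]
      Poly_Mapping.keys_add[of "?p * ?s \<nu>" "?p * ?q"] by (simp only:) blast
  then obtain \<alpha> \<beta> where "\<kappa> = \<alpha> + \<beta>"
    "\<alpha> \<in> Poly_Mapping.keys (?s \<mu> :: _ \<Rightarrow>\<^sub>0 'b) \<and> \<beta> \<in> Poly_Mapping.keys ?q \<or>
     \<alpha> \<in> Poly_Mapping.keys ?p \<and> \<beta> \<in> Poly_Mapping.keys (?s \<nu> :: _ \<Rightarrow>\<^sub>0 'b) \<or>
     \<alpha> \<in> Poly_Mapping.keys ?p \<and> \<beta> \<in> Poly_Mapping.keys ?q"
    using Poly_Mapping.keys_mult[of "?s \<mu>" ?q] Poly_Mapping.keys_mult[of ?p "?s \<nu>"]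
      Poly_Mapping.keys_mult[of ?p ?q] by blast
  then show "weight w (\<mu> + \<nu>) < weight w \<kappa>"
    using assms unfolding lowest_term_def weight_add \<open>\<kappa> = \<alpha> + \<beta>\<close> by (auto intro: add_strict_mono)
qed

lemma lookup_lowest_term:
  assumes "lowest_term w \<mu> p" "weight w \<kappa> \<le> weight w \<mu>"
  shows "Poly_Mapping.lookup p \<kappa> = (1 when \<kappa> = \<mu>)"
proof -
  have "\<kappa> \<notin> Poly_Mapping.keys (p - Poly_Mapping.single \<mu> 1)"
    using assms by (auto simp: lowest_term_def)
  then have "Poly_Mapping.lookup p \<kappa> - Poly_Mapping.lookup (Poly_Mapping.single \<mu> 1) \<kappa> = 0"
    by (simp add: in_keys_iff lookup_minus)
  then show ?thesis
    by (auto simp: lookup_single when_def split: if_splits)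
qed

text \<open>
  Swapping the value \<open>m\<close> into the last position increases the sum strictly, and the first \<open>m\<close>
  positions are left to the induction hypothesis.
\<close>

lemma rearrangement:
  fixes d :: "nat \<Rightarrow> nat"
  assumes "p permutes {..<m}" "\<And>i j. i < j \<Longrightarrow> j < m \<Longrightarrow> d i < d j"
  shows "p \<noteq> id \<Longrightarrow> (\<Sum>i<m. i * d (p i)) < (\<Sum>i<m. i * d i)"
proof -
  have "(\<Sum>i<m. i * d (p i)) \<le> (\<Sum>i<m. i * d i) \<and> (p \<noteq> id \<longrightarrow> (\<Sum>i<m. i * d (p i)) < (\<Sum>i<m. i * d i))"
    using assms
  proof (induction m arbitrary: p)
    case 0
    then show ?case by simp
  next
    case (Suc m)
    have incr: "\<And>i j. i < j \<Longrightarrow> j < m \<Longrightarrow> d i < d j" using Suc.prems(2) by simp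
    have restrict: "q permutes {..<m}" if "q permutes {..<Suc m}" "q m = m" for q
      using that by (intro permutes_superset[OF that(1)]) (auto simp: less_Suc_eq)
    show ?case
    proof (cases "p m = m")
      case True
      then show ?thesis using Suc.IH[OF restrict[OF Suc.prems(1)] incr] by simp
    next
      case False
      define k where "k = Hilbert_Choice.inv p m"
      have pk: "p k = m" unfolding k_def by (rule permutes_inverses(1)[OF Suc.prems(1)])
      have "k < Suc m" using permutes_in_image[OF Suc.prems(1), of k] pk by simp
      with pk False have k: "k < m" by (cases "k = m") auto
      have "p m < Suc m" using permutes_in_image[OF Suc.prems(1), of m] by simp
      with False have l: "p m < m" by simp
      let ?q = "p \<circ> Transposition.transpose k m"
      have "Transposition.transpose k m permutes {..<Suc m}"
        using k by (intro permutes_swap_id) auto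
      then have "?q permutes {..<Suc m}" using Suc.prems(1) by (rule permutes_compose)
      then have q: "?q permutes {..<m}" using pk by (intro restrict) auto
      have split: "(\<Sum>i<Suc m. i * d (f i)) = (\<Sum>i\<in>{..<m} - {k}. i * d (f i)) + k * d (f k) + m * d (f m)"
        for f :: "nat \<Rightarrow> nat"
        using k by (simp add: sum.remove[of "{..<m}" k])
      have same: "(\<Sum>i\<in>{..<m} - {k}. i * d (?q i)) = (\<Sum>i\<in>{..<m} - {k}. i * d (p i))"
        by (intro sum.cong) (auto simp: transpose_def)
      obtain a where a: "m = k + a" "0 < a" using k less_imp_add_positive by blast
      obtain b where b: "0 < b" "d (p m) + b = d m"
        using less_imp_add_positive[OF Suc.prems(2)[OF l lessI]] by blast
      have "k * d m + m * d (p m) < k * d (p m) + m * d m"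
        unfolding b(2)[symmetric] using a b(1) by (simp add: algebra_simps)
      then have "(\<Sum>i<Suc m. i * d (p i)) < (\<Sum>i<Suc m. i * d (?q i))"
        unfolding split same by (simp add: pk)
      also have "\<dots> \<le> (\<Sum>i<Suc m. i * d i)"
        using Suc.IH[OF q incr] by (simp add: pk)
      finally show ?thesis by simp
    qed
  qed
  then show "p \<noteq> id \<Longrightarrow> (\<Sum>i<m. i * d (p i)) < (\<Sum>i<m. i * d i)" by blast
qed

lemma poly_mapping_sum_single:
  fixes p :: "'v \<Rightarrow>\<^sub>0 'a::comm_monoid_add"
  shows "p = (\<Sum>\<mu>\<in>Poly_Mapping.keys p. Poly_Mapping.single \<mu> (Poly_Mapping.lookup p \<mu>))"
  by (rule poly_mapping_eqI) (simp add: lookup_sum lookup_single when_def in_keys_iff)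

definition mon_val :: "('v \<Rightarrow> 'b) \<Rightarrow> ('v \<Rightarrow>\<^sub>0 nat) \<Rightarrow> 'b::comm_ring_1" where
  "mon_val \<sigma> \<mu> = (\<Prod>v\<in>Poly_Mapping.keys \<mu>. \<sigma> v ^ Poly_Mapping.lookup \<mu> v)"

definition poly_subst :: "(nat \<times> nat \<Rightarrow> 'k var_poly) \<Rightarrow> 'k::field var_poly \<Rightarrow> 'k var_poly" where
  "poly_subst \<sigma> p = (\<Sum>\<mu>\<in>Poly_Mapping.keys p. Poly_Mapping.single 0 (Poly_Mapping.lookup p \<mu>) * mon_val \<sigma> \<mu>)"

lemma mon_val_superset:
  assumes "finite A" "Poly_Mapping.keys \<mu> \<subseteq> A"
  shows "mon_val \<sigma> \<mu> = (\<Prod>v\<in>A. \<sigma> v ^ Poly_Mapping.lookup \<mu> v)"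
  unfolding mon_val_def using assms by (intro prod.mono_neutral_left) (auto simp: in_keys_iff)

lemma mon_val_add: "mon_val \<sigma> (\<mu> + \<nu>) = mon_val \<sigma> \<mu> * mon_val \<sigma> \<nu>"
proof -
  let ?A = "Poly_Mapping.keys \<mu> \<union> Poly_Mapping.keys \<nu>"
  show ?thesis
    using Poly_Mapping.keys_add[of \<mu> \<nu>]
    by (subst (1 2 3) mon_val_superset[of ?A]) (auto simp: lookup_add power_add prod.distrib)
qed

lemma poly_subst_superset:
  assumes "finite A" "Poly_Mapping.keys p \<subseteq> A"
  shows "poly_subst \<sigma> p = (\<Sum>\<mu>\<in>A. Poly_Mapping.single 0 (Poly_Mapping.lookup p \<mu>) * mon_val \<sigma> \<mu>)"
  unfolding poly_subst_def using assms by (intro sum.mono_neutral_left) (auto simp: in_keys_iff)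

lemma poly_subst_add: "poly_subst \<sigma> (p + q) = poly_subst \<sigma> p + poly_subst \<sigma> q"
proof -
  let ?A = "Poly_Mapping.keys p \<union> Poly_Mapping.keys q"
  show ?thesis
    using Poly_Mapping.keys_add[of p q]
    by (subst (1 2 3) poly_subst_superset[of ?A]) (auto simp: lookup_add single_add algebra_simps sum.distrib)
qed

lemma poly_subst_zero: "poly_subst \<sigma> 0 = 0"
  by (simp add: poly_subst_def)

lemma poly_subst_single: "poly_subst \<sigma> (Poly_Mapping.single \<mu> c) = Poly_Mapping.single 0 c * mon_val \<sigma> \<mu>"
  by (subst poly_subst_superset[of "{\<mu>}"]) auto

lemma poly_subst_sum: "poly_subst \<sigma> (sum f A) = (\<Sum>a\<in>A. poly_subst \<sigma> (f a))"
  by (induction A rule: infinite_finite_induct) (simp_all add: poly_subst_add poly_subst_zero)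

lemma poly_subst_mult: "poly_subst \<sigma> (p * q) = poly_subst \<sigma> p * poly_subst \<sigma> q"
proof -
  let ?s = "\<lambda>p \<mu>. Poly_Mapping.single \<mu> (Poly_Mapping.lookup p \<mu>)"
  have const_mult: "Poly_Mapping.single 0 (a * b) = Poly_Mapping.single 0 a * (Poly_Mapping.single 0 b :: 'a var_poly)" for a b
    by (simp add: mult_single)
  have "poly_subst \<sigma> (?s p \<mu> * ?s q \<nu>) = poly_subst \<sigma> (?s p \<mu>) * poly_subst \<sigma> (?s q \<nu>)" for \<mu> \<nu>
    unfolding mult_single poly_subst_single mon_val_add
    by (simp only: const_mult mult_ac)
  then have "poly_subst \<sigma> ((\<Sum>\<mu>\<in>Poly_Mapping.keys p. ?s p \<mu>) * (\<Sum>\<nu>\<in>Poly_Mapping.keys q. ?s q \<nu>)) =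
    poly_subst \<sigma> (\<Sum>\<mu>\<in>Poly_Mapping.keys p. ?s p \<mu>) * poly_subst \<sigma> (\<Sum>\<nu>\<in>Poly_Mapping.keys q. ?s q \<nu>)"
    by (simp only: sum_product poly_subst_sum)
  then show ?thesis
    by (simp only: poly_mapping_sum_single[symmetric])
qed

lemma comm_ring_hom_poly_subst: "comm_ring_hom (poly_subst \<sigma>)"
proof
  show "poly_subst \<sigma> 1 = 1"
    using poly_subst_single[of \<sigma> 0 1] by (simp add: mon_val_def)
qed (simp_all add: poly_subst_zero poly_subst_add poly_subst_mult)

lemma poly_subst_const: "poly_subst \<sigma> (Poly_Mapping.single 0 c) = Poly_Mapping.single 0 c"
  by (simp add: poly_subst_single mon_val_def)

lemma poly_subst_var: "poly_subst \<sigma> (var i j) = \<sigma> (i, j)"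
  by (simp add: var_def poly_subst_single mon_val_def)

section \<open>Linear independence of the standard products\<close>

definition bordered :: "nat \<Rightarrow> nat \<Rightarrow> nat \<Rightarrow> 'k::field var_poly" where
  "bordered n i c = (if c < n then var i c else if c = n + i then 1 else 0)"

text \<open>
  The matrix \<open>(X | G)\<close> with \<open>G\<close> lower unitriangular: all entries that are not forced to be \<open>0\<close> or
  \<open>1\<close> are distinct variables. The entry \<open>1\<close> in row \<open>i\<close> is at column \<open>n + i\<close>, which is also the largest
  column that can be the \<open>i\<close>-th member of an \<open>m\<close>-set.
\<close>

definition unitri :: "nat \<Rightarrow> nat \<Rightarrow> nat \<Rightarrow> 'k::field var_poly" where
  "unitri n i c = (if c < n + i then var i c else if c = n + i then 1 else 0)"

text \<open>
  The exponent of the entry \<open>(i, c)\<close> of \<open>(X | G)\<close>; it is \<open>0\<close> where that entry is \<open>1\<close>.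
\<close>

definition diag_cell :: "nat \<Rightarrow> nat \<Rightarrow> nat \<Rightarrow> (nat \<times> nat) \<Rightarrow>\<^sub>0 nat" where
  "diag_cell n i c = (if c < n + i then Poly_Mapping.single (i, c) 1 else 0)"

definition diag_monomial :: "nat \<Rightarrow> nat \<Rightarrow> nat set \<Rightarrow> (nat \<times> nat) \<Rightarrow>\<^sub>0 nat" where
  "diag_monomial m n C = (\<Sum>i<m. diag_cell n i (pick C i))"

text \<open>
  Up to a constant for each row this is \<open>- i * c\<close>, and every product in the Leibniz formula uses
  each row once. So minimizing the weight means maximizing \<open>\<Sum>i. i * c(p i)\<close>, which singles out the
  identity by rearrangement. The constants make the entries \<open>1\<close> have weight \<open>0\<close>.
\<close>

abbreviation diag_weight :: "nat \<Rightarrow> nat \<times> nat \<Rightarrow> nat" where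
  "diag_weight n v \<equiv> (case v of (i, c) \<Rightarrow> i * (n + i - c))"

lemma col_setsD:
  assumes "C \<in> col_sets m N"
  shows "C \<subseteq> {..<N}" "card C = m" "finite C"
  using assms finite_subset by (auto simp: col_sets_def)

lemma pick_col_set:
  assumes "C \<in> col_sets m N" "i < m"
  shows "pick C i \<in> C" "pick C i < N"
  using assms pick_in_set_le[of i C] col_setsD[OF assms(1)] by auto

lemma card_less_pick:
  assumes "C \<in> col_sets m N" "i < m"
  shows "card (C \<inter> {..<pick C i}) = i"
proof -
  have "C \<inter> {..<pick C i} = {a\<in>C. a < pick C i}" by auto
  then show ?thesis using card_pick_le[of i C] assms col_setsD[OF assms(1)] by simp
qed

lemma pick_le_col:
  assumes C: "C \<in> col_sets m (n + m)" and i: "i < m"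
  shows "pick C i \<le> n + i"
proof -
  have "C \<inter> {pick C i..} \<subseteq> {pick C i..<n + m}"
    using col_setsD[OF C] by auto
  then have "card (C \<inter> {pick C i..}) \<le> n + m - pick C i"
    using card_mono[of "{pick C i..<n + m}"] by simp
  moreover have "card (C \<inter> {pick C i..}) = m - i"
    using card_Int_lessThan_add[of C "pick C i"] card_less_pick[OF assms] col_setsD[OF C] by simp
  ultimately show ?thesis using i pick_col_set[OF assms] by simp
qed

lemma prod_single_one:
  "(\<Prod>i\<in>A. Poly_Mapping.single (f i) (1::'k::comm_ring_1)) = Poly_Mapping.single (sum f A :: 'v \<Rightarrow>\<^sub>0 nat) 1"
  by (induction A rule: infinite_finite_induct) (simp_all add: mult_single)

lemma unitri_eq_single: "c \<le> n + i \<Longrightarrow> unitri n i c = Poly_Mapping.single (diag_cell n i c) 1"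
  by (auto simp: unitri_def diag_cell_def var_def)

lemma weight_diag_cell: "weight (diag_weight n) (diag_cell n i c) = i * (n + i - c)"
  by (auto simp: diag_cell_def)

lemma lowest_term_bracket:
  assumes C: "C \<in> col_sets m (n + m)"
  shows "lowest_term (diag_weight n) (diag_monomial m n C) (bracket m (unitri n) C :: 'k::field var_poly)"
  unfolding lowest_term_def
proof
  let ?S = "{p. p permutes {0..<m}}"
  let ?T = "\<lambda>p. \<Prod>i = 0..<m. unitri n i (pick C (p i)) :: 'k var_poly"
  let ?mon = "\<lambda>p. \<Sum>i<m. diag_cell n i (pick C (p i))"
  have T: "?T p = Poly_Mapping.single (?mon p) 1" if "\<forall>i<m. pick C (p i) \<le> n + i" for p
    using that by (simp add: unitri_eq_single prod_single_one atLeast0LessThan)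
  have T0: "?T p = 0" if i: "i < m" "\<not> pick C (p i) \<le> n + i" for p i
  proof (rule prod_zero)
    show "\<exists>i\<in>{0..<m}. unitri n i (pick C (p i)) = (0 :: 'k var_poly)"
      using i by (intro bexI[of _ i]) (simp_all add: unitri_def)
  qed simp
  have "bracket m (unitri n) C = (\<Sum>p\<in>?S. signof p * ?T p)"
    unfolding bracket_def by (rule fdet_leibniz)
  also have "\<dots> = signof id * ?T id + (\<Sum>p\<in>?S - {id}. signof p * ?T p)"
    by (rule sum.remove) (auto simp: finite_permutations permutes_id)
  also have "?T id = Poly_Mapping.single (diag_monomial m n C) 1"
    using T[of id] pick_le_col[OF C] by (simp add: diag_monomial_def)
  finally have eq: "bracket m (unitri n) C - Poly_Mapping.single (diag_monomial m n C) 1 =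
      (\<Sum>p\<in>?S - {id}. signof p * ?T p)"
    by (simp add: id_def)
  fix \<kappa> assume "\<kappa> \<in> Poly_Mapping.keys (bracket m (unitri n) C - Poly_Mapping.single (diag_monomial m n C) (1::'k))"
  then obtain p where p: "p permutes {0..<m}" "p \<noteq> id" and key: "\<kappa> \<in> Poly_Mapping.keys (signof p * ?T p)"
    unfolding eq using Poly_Mapping.keys_sum[of "\<lambda>p. signof p * ?T p" "?S - {id}"] by blast
  have key': "\<kappa> \<in> Poly_Mapping.keys (?T p)"
    using key signof_cases[of p, where ?'a = "'k var_poly"] by auto
  then have le: "\<forall>i<m. pick C (p i) \<le> n + i"
    using T0[of _ p] by (metis keys_zero empty_iff)
  then have \<kappa>: "\<kappa> = ?mon p"
    using key' unfolding T[OF le] by (simp split: if_splits)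
  have "(\<Sum>i<m. i * pick C (p i)) < (\<Sum>i<m. i * pick C i)"
    using rearrangement[of p m "pick C"] p pick_mono_le[of _ C] col_setsD[OF C]
    by (simp add: atLeast0LessThan)
  moreover have "weight (diag_weight n) (?mon q) + (\<Sum>i<m. i * pick C (q i)) = (\<Sum>i<m. i * (n + i))"
    if "\<forall>i<m. pick C (q i) \<le> n + i" for q
    unfolding weight_sum weight_diag_cell sum.distrib[symmetric]
    using that by (intro sum.cong) (auto simp flip: distrib_left)
  from this[OF le] this[of id] have
    "weight (diag_weight n) (?mon p) + (\<Sum>i<m. i * pick C (p i)) = weight (diag_weight n) (diag_monomial m n C) + (\<Sum>i<m. i * pick C i)"
    using pick_le_col[OF C] by (simp add: diag_monomial_def)
  ultimately show "weight (diag_weight n) (diag_monomial m n C) < weight (diag_weight n) \<kappa>"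
    unfolding \<kappa> by simp
qed

lemma lowest_term_bracket_prod:
  assumes "set L \<subseteq> col_sets m (n + m)"
  shows "lowest_term (diag_weight n) (\<Sum>C\<leftarrow>L. diag_monomial m n C) (bracket_prod m (unitri n) L :: 'k::field var_poly)"
  using assms by (induction L) (auto simp: lowest_term_one intro!: lowest_term_mult lowest_term_bracket)

text \<open>
  Leaving out the trivial bracket, which equals \<open>1\<close>, is what makes distinct chains have distinct
  products.
\<close>

definition std_chains :: "nat \<Rightarrow> nat \<Rightarrow> nat set list set" where
  "std_chains m n = {L. set L \<subseteq> col_sets m (n + m) - {{n..<n + m}} \<and> sorted_wrt col_le L}"

lemma lookup_diag_monomial:
  assumes "i < m" "c < n + i"
  shows "Poly_Mapping.lookup (diag_monomial m n C) (i, c) = (if pick C i = c then 1 else 0)"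
proof -
  have "Poly_Mapping.lookup (diag_monomial m n C) (i, c) = (\<Sum>j<m. if j = i then (if pick C i = c then 1 else 0) else 0)"
    unfolding diag_monomial_def lookup_sum using assms
    by (intro sum.cong) (auto simp: diag_cell_def lookup_single when_def)
  then show ?thesis using assms by simp
qed

lemma lookup_sum_list_diag_monomial:
  assumes "i < m" "c < n + i"
  shows "Poly_Mapping.lookup (\<Sum>C\<leftarrow>L. diag_monomial m n C) (i, c) = count_list (map (\<lambda>C. pick C i) L) c"
  by (induction L) (auto simp: lookup_add lookup_diag_monomial[OF assms])

lemma col_le_pick:
  assumes "C \<in> col_sets m N" "D \<in> col_sets m N" "col_le C D" "i < m"
  shows "pick C i \<le> pick D i"
proof (rule ccontr)
  assume less: "\<not> pick C i \<le> pick D i"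
  have "insert (pick D i) (D \<inter> {..<pick D i}) \<subseteq> D \<inter> {..<pick C i}"
    using less pick_col_set[OF assms(2,4)] by auto
  then have "card (insert (pick D i) (D \<inter> {..<pick D i})) \<le> card (D \<inter> {..<pick C i})"
    using col_setsD[OF assms(2)] by (intro card_mono) auto
  then have "Suc i \<le> card (D \<inter> {..<pick C i})"
    using card_less_pick[OF assms(2,4)] col_setsD[OF assms(2)] by simp
  also have "\<dots> \<le> card (C \<inter> {..<pick C i})"
    using assms(3) by (simp add: col_le_def)
  finally show False using card_less_pick[OF assms(1,4)] by simp
qed

lemma eq_sorted_counts:
  fixes xs ys :: "nat list"
  assumes "sorted xs" "sorted ys" "length xs = length ys" "set xs \<subseteq> {..b}" "set ys \<subseteq> {..b}"
    and cnt: "\<And>c. c < b \<Longrightarrow> count_list xs c = count_list ys c"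
  shows "xs = ys"
proof -
  have total: "(\<Sum>c<b. count_list zs c) + count_list zs b = length zs" if "set zs \<subseteq> {..b}" for zs
    using sum_count_set[OF that] by (simp add: lessThan_Suc_atMost[symmetric])
  have "count_list xs b = count_list ys b"
    using total[OF assms(4)] total[OF assms(5)] cnt assms(3) by simp
  then have "count_list xs c = count_list ys c" for c
    using cnt[of c] assms(4,5) count_list_0_iff[of xs c] count_list_0_iff[of ys c]
    by (cases c b rule: linorder_cases) auto
  then have "mset xs = mset ys"
    by (intro multiset_eqI) (simp add: count_mset)
  then show ?thesis
    using assms(1,2) by (metis properties_for_sort)
qed

text \<open>
  For fixed \<open>i\<close> the \<open>i\<close>-th members along a chain increase weakly, so it is enough to know how often
  each column occurs among them. The exponents tell this for all columns but \<open>n + i\<close>, and the last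
  number follows from the length of the chain. The length is visible in row \<open>0\<close>: the least column
  of a nontrivial bracket is below \<open>n\<close>.
\<close>

lemma inj_on_diag_monomial: "inj_on (\<lambda>L. \<Sum>C\<leftarrow>L. diag_monomial m n C) (std_chains m n)"
proof (rule inj_onI)
  fix K L
  assume K: "K \<in> std_chains m n" and L: "L \<in> std_chains m n"
    and eq: "(\<Sum>C\<leftarrow>K. diag_monomial m n C) = (\<Sum>C\<leftarrow>L. diag_monomial m n C)"
  have cols: "\<And>C. C \<in> set M \<Longrightarrow> C \<in> col_sets m (n + m)" if "M \<in> std_chains m n" for M
    using that by (auto simp: std_chains_def)
  have cnt: "count_list (map (\<lambda>C. pick C i) K) c = count_list (map (\<lambda>C. pick C i) L) c" if "i < m" "c < n + i" for i c
    using eq lookup_sum_list_diag_monomial[OF that, of K] lookup_sum_list_diag_monomial[OF that, of L] by simp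
  have srt: "sorted (map (\<lambda>C. pick C i) M)" if M: "M \<in> std_chains m n" and i: "i < m" for M i
    unfolding sorted_map
    by (rule sorted_wrt_mono_rel[of M col_le]) (use M i col_le_pick[OF cols[OF M] cols[OF M] _ i] in \<open>auto simp: std_chains_def\<close>)
  have len: "length M = (\<Sum>c<n. count_list (map (\<lambda>C. pick C 0) M) c)" if M: "M \<in> std_chains m n" and "0 < m" for M
  proof -
    have "pick C 0 < n" if C: "C \<in> set M" for C
    proof (rule ccontr)
      assume n: "\<not> pick C 0 < n"
      have "C \<subseteq> {n..<n + m}"
      proof
        fix c assume c: "c \<in> C"
        then have "pick C 0 \<le> c" by (simp add: Least_le)
        then show "c \<in> {n..<n + m}" using n c col_setsD(1)[OF cols[OF M C]] by auto
      qed
      then have "C = {n..<n + m}"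
        using col_setsD[OF cols[OF M C]] by (intro card_subset_eq) auto
      then show False using M C by (auto simp: std_chains_def)
    qed
    then show ?thesis
      by (subst sum_count_set) auto
  qed
  show "K = L"
  proof (cases "m = 0")
    case True
    have "M = []" if "M \<in> std_chains m n" for M
      using that True by (cases M) (auto simp: std_chains_def col_sets_def finite_subset)
    from this[OF K] this[OF L] show ?thesis by simp
  next
    case False
    then have "length K = length L"
      using len[OF K] len[OF L] cnt[of 0] by simp
    moreover have "map (\<lambda>C. pick C i) K = map (\<lambda>C. pick C i) L" if i: "i < m" for i
      by (rule eq_sorted_counts[of _ _ "n + i"])
        (use srt[OF K i] srt[OF L i] \<open>length K = length L\<close> cnt[OF i] pick_le_col[OF _ i] cols[OF K] cols[OF L] in auto)
    then have pk: "pick (K ! k) i = pick (L ! k) i" if "i < m" "k < length K" for i k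
      using that \<open>length K = length L\<close> by (metis nth_map)
    have "K ! k = L ! k" if k: "k < length K" for k
    proof -
      have "M ! k = pick (M ! k) ` {..<m}" if M: "M \<in> std_chains m n" "k < length M" for M
        using pick_enumerates(2)[of "M ! k"] col_setsD[OF cols[OF M(1) nth_mem[OF M(2)]]] by simp
      then show ?thesis using K L k \<open>length K = length L\<close> pk by (metis (no_types, lifting) image_cong lessThan_iff)
    qed
    ultimately show ?thesis by (intro nth_equalityI) auto
  qed
qed

text \<open>
  With \<open>H\<close> the inverse of \<open>G\<close>, the substitution of \<open>H X\<close> for \<open>X\<close> carries \<open>(X | 1)\<close> to
  \<open>(H X | 1) = H (X | G)\<close>, and \<open>det G = 1\<close>. The inverse has polynomial entries, being the adjugate.
\<close>

lemma ex_hom_bracket: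
  "\<exists>\<phi>. comm_ring_hom \<phi> \<and> (\<forall>c. \<phi> (Poly_Mapping.single 0 c) = Poly_Mapping.single 0 c) \<and>
    (\<forall>C\<in>col_sets m (n + m). \<phi> (bracket m (bordered n) C) = (bracket m (unitri n) C :: 'k::field var_poly))"
proof -
  define G :: "'k var_poly mat" where "G = mat m m (\<lambda>(i, j). unitri n i (n + j))"
  define H where "H = adj_mat G"
  have G: "G \<in> carrier_mat m m" by (simp add: G_def)
  have H: "H \<in> carrier_mat m m" unfolding H_def by (rule adj_mat(1)[OF G])
  have "diag_mat G = replicate m 1"
    by (intro nth_equalityI) (auto simp: diag_mat_def G_def unitri_def)
  then have detG: "det G = 1"
    using G by (subst det_lower_triangular[OF _ G]) (auto simp: G_def unitri_def)
  have "G * H = 1 \<cdot>\<^sub>m 1\<^sub>m m"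
    using adj_mat(2)[OF G] detG unfolding H_def by simp
  also have "\<dots> = 1\<^sub>m m"
    by (intro eq_matI) auto
  finally have GH: "G * H = 1\<^sub>m m" .
  define \<phi> where "\<phi> = poly_subst (\<lambda>(i, j). \<Sum>k<m. H $$ (i, k) * var k j :: 'k var_poly)"
  interpret \<phi>: comm_ring_hom \<phi>
    unfolding \<phi>_def by (rule comm_ring_hom_poly_subst)
  have entry: "(\<Sum>l<m. G $$ (i, l) * \<phi> (bordered n l c)) = unitri n i c" if i: "i < m" and c: "c < n + m" for i c
  proof (cases "c < n")
    case True
    have "(\<Sum>l<m. G $$ (i, l) * \<phi> (bordered n l c)) = (\<Sum>l<m. \<Sum>k<m. G $$ (i, l) * H $$ (l, k) * var k c)"
      using True by (simp add: bordered_def \<phi>_def poly_subst_var sum_distrib_left mult.assoc)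
    also have "\<dots> = (\<Sum>k<m. \<Sum>l<m. G $$ (i, l) * H $$ (l, k) * var k c)"
      by (rule sum.swap)
    also have "\<dots> = (\<Sum>k<m. (G * H) $$ (i, k) * var k c)"
      using i G H by (intro sum.cong) (auto simp: scalar_prod_def sum_distrib_right atLeast0LessThan)
    also have "\<dots> = (\<Sum>k<m. if k = i then var i c else 0)"
      unfolding GH using i by (intro sum.cong) auto
    finally show ?thesis using True i by (simp add: unitri_def)
  next
    case False
    then obtain j where j: "c = n + j" "j < m"
      using c by (metis add_less_cancel_left le_Suc_ex not_le)
    have "(\<Sum>l<m. G $$ (i, l) * \<phi> (bordered n l c)) = (\<Sum>l<m. if l = j then G $$ (i, j) else 0)"
      using j by (intro sum.cong) (auto simp: bordered_def)
    then show ?thesis using i j by (simp add: G_def)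
  qed
  have "\<phi> (bracket m (bordered n) C) = bracket m (unitri n) C" if C: "C \<in> col_sets m (n + m)" for C
  proof -
    let ?A = "mat m m (\<lambda>(i, j). bordered n i (pick C j)) :: 'k var_poly mat"
    have "G * map_mat \<phi> ?A = mat m m (\<lambda>(i, j). unitri n i (pick C j))"
    proof (rule eq_matI)
      fix i j assume "i < dim_row (mat m m (\<lambda>(i, j). unitri n i (pick C j)))"
        "j < dim_col (mat m m (\<lambda>(i, j). unitri n i (pick C j)))"
      then have ij: "i < m" "j < m" by simp_all
      then show "(G * map_mat \<phi> ?A) $$ (i, j) = mat m m (\<lambda>(i, j). unitri n i (pick C j)) $$ (i, j)"
        using G entry[OF ij(1) pick_col_set(2)[OF C ij(2)]]
        by (simp add: scalar_prod_def atLeast0LessThan)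
    qed (use G in simp_all)
    moreover have "det (G * map_mat \<phi> ?A) = det G * det (map_mat \<phi> ?A)"
      by (rule det_mult[OF G]) simp
    ultimately show ?thesis
      unfolding bracket_def using detG by simp
  qed
  then show ?thesis
    using \<phi>.comm_ring_hom_axioms by (intro exI[of _ \<phi>]) (auto simp: \<phi>_def poly_subst_const)
qed

text \<open>
  After the substitution, take a product whose diagonal monomial has least weight among the products
  with nonzero coefficient. That monomial occurs in no other product of the relation: their lowest
  terms are different monomials, and all else in them has larger weight.
\<close>

theorem standard_products_independent:
  fixes \<alpha> :: "nat set list \<Rightarrow> 'k::field"
  assumes F: "finite F" "F \<subseteq> std_chains m n"
    and sum0: "(\<Sum>L\<in>F. Poly_Mapping.single 0 (\<alpha> L) * bracket_prod m (bordered n) L) = 0"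
    and L: "L \<in> F"
  shows "\<alpha> L = 0"
proof (rule ccontr)
  assume nz: "\<alpha> L \<noteq> 0"
  let ?mon = "\<lambda>L. \<Sum>C\<leftarrow>L. diag_monomial m n C"
  let ?w = "weight (diag_weight n)"
  obtain \<phi> :: "'k var_poly \<Rightarrow> 'k var_poly" where hom: "comm_ring_hom \<phi>"
    and const: "\<And>c. \<phi> (Poly_Mapping.single 0 c) = Poly_Mapping.single 0 c"
    and br: "\<And>C. C \<in> col_sets m (n + m) \<Longrightarrow> \<phi> (bracket m (bordered n) C) = bracket m (unitri n) C"
    using ex_hom_bracket[of m n] by blast
  interpret \<phi>: comm_ring_hom \<phi> by (rule hom)
  have cols: "set K \<subseteq> col_sets m (n + m)" if "K \<in> F" for K
    using that F(2) by (auto simp: std_chains_def)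
  have prod: "\<phi> (bracket_prod m (bordered n) K) = bracket_prod m (unitri n) K" if "set K \<subseteq> col_sets m (n + m)" for K
    using that by (induction K) (auto simp: br \<phi>.hom_mult)
  have "(\<Sum>K\<in>F. Poly_Mapping.single 0 (\<alpha> K) * bracket_prod m (unitri n) K) =
      \<phi> (\<Sum>K\<in>F. Poly_Mapping.single 0 (\<alpha> K) * bracket_prod m (bordered n) K)"
    using cols by (simp add: \<phi>.hom_sum \<phi>.hom_mult const prod)
  then have sum0': "(\<Sum>K\<in>F. Poly_Mapping.single 0 (\<alpha> K) * bracket_prod m (unitri n) K) = 0"
    by (simp add: sum0)
  obtain M where M: "M \<in> F" "\<alpha> M \<noteq> 0" "\<And>K. K \<in> F \<Longrightarrow> \<alpha> K \<noteq> 0 \<Longrightarrow> ?w (?mon M) \<le> ?w (?mon K)"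
    using ex_min_if_finite[of "(\<lambda>K. ?w (?mon K)) ` {K\<in>F. \<alpha> K \<noteq> 0}"] F(1) L nz
    by (auto simp: not_less) 
  have scale: "Poly_Mapping.lookup (Poly_Mapping.single 0 c * p) \<mu> = c * Poly_Mapping.lookup p \<mu>"
    for c and p :: "'k var_poly" and \<mu>
    by (simp add: map.rep_eq when_def flip: mult_map_scale_conv_mult)
  have "0 = Poly_Mapping.lookup (\<Sum>K\<in>F. Poly_Mapping.single 0 (\<alpha> K) * bracket_prod m (unitri n) K) (?mon M)"
    unfolding sum0' by simp
  also have "\<dots> = (\<Sum>K\<in>F. \<alpha> K * Poly_Mapping.lookup (bracket_prod m (unitri n) K) (?mon M))"
    by (simp add: lookup_sum scale)
  also have "\<dots> = (\<Sum>K\<in>F. if K = M then \<alpha> M else 0)"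
  proof (rule sum.cong[OF refl])
    fix K assume K: "K \<in> F"
    show "\<alpha> K * Poly_Mapping.lookup (bracket_prod m (unitri n) K) (?mon M) = (if K = M then \<alpha> M else 0)"
    proof (cases "\<alpha> K = 0")
      case False
      have "Poly_Mapping.lookup (bracket_prod m (unitri n) K) (?mon M) = (1 when ?mon M = ?mon K :: 'k)"
        using lookup_lowest_term[OF lowest_term_bracket_prod[OF cols[OF K]] M(3)[OF K False]] .
      moreover have "?mon M = ?mon K \<longleftrightarrow> K = M"
        using inj_onD[OF inj_on_diag_monomial, of m n M K] K M(1) F(2) by blast
      ultimately show ?thesis by (simp add: when_def)
    qed (use M(2) in auto)
  qed
  also have "\<dots> = \<alpha> M" using F(1) M(1) by simp
  finally show False using M(2) by simp
qed

lemma inj_on_bracket_prod: "inj_on (bracket_prod m (bordered n) :: _ \<Rightarrow> 'k::field var_poly) (std_chains m n)"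
proof (rule inj_onI, rule ccontr)
  fix K L
  assume KL: "K \<in> std_chains m n" "L \<in> std_chains m n" "K \<noteq> L"
    and eq: "bracket_prod m (bordered n) K = (bracket_prod m (bordered n) L :: 'k var_poly)"
  have "(if K = K then 1 else - 1 :: 'k) = 0"
    by (rule standard_products_independent[of "{K, L}" m n "\<lambda>M. if M = K then 1 else - 1"])
      (use KL eq in \<open>auto simp: single_uminus\<close>)
  then show False by simp
qed

lemma independent_bracket_prod: "kspan.independent (bracket_prod m (bordered n) ` std_chains m n :: 'k::field var_poly set)"
  unfolding kspan.independent_explicit_module
proof (intro allI impI)
  fix t and u :: "'k var_poly \<Rightarrow> 'k" and v
  assume t: "finite t" "t \<subseteq> bracket_prod m (bordered n) ` std_chains m n"
    and sum0: "(\<Sum>v\<in>t. Poly_Mapping.single 0 (u v) * v) = 0" and v: "v \<in> t"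
  obtain F where F: "F \<subseteq> std_chains m n" "finite F" "t = bracket_prod m (bordered n) ` F"
    using finite_subset_image[OF t] by blast
  have "inj_on (bracket_prod m (bordered n) :: _ \<Rightarrow> 'k var_poly) F"
    using inj_on_bracket_prod F(1) by (rule inj_on_subset)
  then have "(\<Sum>L\<in>F. Poly_Mapping.single 0 (u (bracket_prod m (bordered n) L)) * bracket_prod m (bordered n) L) = 0"
    using sum0 unfolding F(3) by (subst (asm) sum.reindex) auto
  then show "u v = 0"
    using standard_products_independent[OF F(2,1), of "\<lambda>L. u (bracket_prod m (bordered n) L)"] v F(3) by auto
qed

lemma span_Int_subset_independent:
  fixes B :: "'k::field var_poly set"
  assumes B: "kspan.independent B" and S: "S \<subseteq> B" "T \<subseteq> B"
  shows "kspan.span S \<inter> kspan.span T \<subseteq> kspan.span (S \<inter> T)"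
proof
  fix p assume p: "p \<in> kspan.span S \<inter> kspan.span T"
  obtain f where f: "p = (\<Sum>v | f v \<noteq> 0. Poly_Mapping.single 0 (f v) * v)" "finite {v. f v \<noteq> 0}"
    "\<And>v. f v \<noteq> 0 \<Longrightarrow> v \<in> S"
    using p unfolding kspan.span_explicit' by blast
  obtain g where g: "p = (\<Sum>v | g v \<noteq> 0. Poly_Mapping.single 0 (g v) * v)" "finite {v. g v \<noteq> 0}"
    "\<And>v. g v \<noteq> 0 \<Longrightarrow> v \<in> T"
    using p unfolding kspan.span_explicit' by blast
  have "f = g"
    by (rule kspan.independentD_unique[OF B]) (use f g S in auto)
  then show "p \<in> kspan.span (S \<inter> T)"
    unfolding kspan.span_explicit' using f g by blast
qed

corollary span_bracket_prod_Int:
  assumes "S \<subseteq> std_chains m n" "T \<subseteq> std_chains m n"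
  shows "kspan.span (bracket_prod m (bordered n) ` S) \<inter> kspan.span (bracket_prod m (bordered n) ` T) =
    (kspan.span (bracket_prod m (bordered n) ` (S \<inter> T)) :: 'k::field var_poly set)" (is "?l = ?r")
proof
  have "?l \<subseteq> kspan.span (bracket_prod m (bordered n) ` S \<inter> bracket_prod m (bordered n) ` T)"
    by (rule span_Int_subset_independent[OF independent_bracket_prod image_mono[OF assms(1)] image_mono[OF assms(2)]])
  then show "?l \<subseteq> ?r"
    by (simp add: inj_on_image_Int[OF inj_on_bracket_prod assms])
  show "?r \<subseteq> ?l"
    by (intro Int_greatest kspan.span_mono image_mono) auto
qed

section \<open>The ring of the generic matrix\<close>

lemma carrier_poly_ring_iff:
  "p \<in> carrier (poly_ring m n) \<longleftrightarrow> (\<forall>\<mu>\<in>Poly_Mapping.keys p. Poly_Mapping.keys \<mu> \<subseteq> {..<m} \<times> {..<n})"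
  by (simp add: poly_ring_def)

lemma poly_ring_ops [simp]:
  "monoid.mult (poly_ring m n) = (*)" "monoid.one (poly_ring m n) = 1"
  "ring.zero (poly_ring m n) = 0" "ring.add (poly_ring m n) = (+)"
  by (simp_all add: poly_ring_def)

lemma poly_ring_closed:
  fixes p q :: "'k::field var_poly"
  shows "(0 :: 'k var_poly) \<in> carrier (poly_ring m n)" "(1 :: 'k var_poly) \<in> carrier (poly_ring m n)"
    and "p \<in> carrier (poly_ring m n) \<Longrightarrow> q \<in> carrier (poly_ring m n) \<Longrightarrow> p + q \<in> carrier (poly_ring m n)"
    and "p \<in> carrier (poly_ring m n) \<Longrightarrow> q \<in> carrier (poly_ring m n) \<Longrightarrow> p * q \<in> carrier (poly_ring m n)"
    and "p \<in> carrier (poly_ring m n) \<Longrightarrow> - p \<in> carrier (poly_ring m n)"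
    and "(Poly_Mapping.single 0 c :: 'k var_poly) \<in> carrier (poly_ring m n)"
proof -
  interpret cring "poly_ring m n :: 'k var_poly ring" by (rule cring_poly_ring)
  show "(0 :: 'k var_poly) \<in> carrier (poly_ring m n)" "(1 :: 'k var_poly) \<in> carrier (poly_ring m n)"
    using zero_closed one_closed by simp_all
  show "p \<in> carrier (poly_ring m n) \<Longrightarrow> q \<in> carrier (poly_ring m n) \<Longrightarrow> p + q \<in> carrier (poly_ring m n)"
    using a_closed by simp
  show "p \<in> carrier (poly_ring m n) \<Longrightarrow> q \<in> carrier (poly_ring m n) \<Longrightarrow> p * q \<in> carrier (poly_ring m n)"
    using m_closed by simp
  show "p \<in> carrier (poly_ring m n) \<Longrightarrow> - p \<in> carrier (poly_ring m n)"
    by (simp add: carrier_poly_ring_iff)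
  show "(Poly_Mapping.single 0 c :: 'k var_poly) \<in> carrier (poly_ring m n)"
    by (simp add: carrier_poly_ring_iff)
qed

lemma poly_ring_sum_closed:
  "(\<And>a. a \<in> A \<Longrightarrow> f a \<in> carrier (poly_ring m n)) \<Longrightarrow> sum f A \<in> carrier (poly_ring m n)"
  by (induction A rule: infinite_finite_induct) (auto intro: poly_ring_closed)

lemma poly_ring_prod_closed:
  "(\<And>a. a \<in> A \<Longrightarrow> f a \<in> carrier (poly_ring m n)) \<Longrightarrow> prod f A \<in> carrier (poly_ring m n)"
  by (induction A rule: infinite_finite_induct) (auto intro: poly_ring_closed)

lemma ideal_poly_ringD:
  fixes I :: "'k::field var_poly set"
  assumes "ideal I (poly_ring m n)"
  shows "I \<subseteq> carrier (poly_ring m n)" "0 \<in> I"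
    and "p \<in> I \<Longrightarrow> q \<in> I \<Longrightarrow> p + q \<in> I"
    and "p \<in> carrier (poly_ring m n) \<Longrightarrow> q \<in> I \<Longrightarrow> p * q \<in> I"
    and "p \<in> I \<Longrightarrow> - p \<in> I"
proof -
  interpret ideal I "poly_ring m n" by (rule assms)
  show "I \<subseteq> carrier (poly_ring m n)" "0 \<in> I" "p \<in> I \<Longrightarrow> q \<in> I \<Longrightarrow> p + q \<in> I"
    using a_subset additive_subgroup.zero_closed[OF is_additive_subgroup]
      additive_subgroup.a_closed[OF is_additive_subgroup] by simp_all
  show mult: "p \<in> carrier (poly_ring m n) \<Longrightarrow> q \<in> I \<Longrightarrow> p * q \<in> I" for p q
    using I_l_closed[of q p] by simp
  show "p \<in> I \<Longrightarrow> - p \<in> I"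
    using mult[OF poly_ring_closed(5)[OF poly_ring_closed(2)], of p] by simp
qed

lemma ideal_poly_ring_sum:
  fixes I :: "'k::field var_poly set"
  assumes "ideal I (poly_ring m n)"
  shows "(\<And>a. a \<in> A \<Longrightarrow> f a \<in> I) \<Longrightarrow> sum f A \<in> I"
  by (induction A rule: infinite_finite_induct) (auto intro: ideal_poly_ringD(2,3)[OF assms])

lemma ideal_poly_ringI:
  fixes I :: "'k::field var_poly set"
  assumes sub: "I \<subseteq> carrier (poly_ring m n)" and zero: "0 \<in> I"
    and add: "\<And>p q. p \<in> I \<Longrightarrow> q \<in> I \<Longrightarrow> p + q \<in> I"
    and mult: "\<And>p q. p \<in> carrier (poly_ring m n) \<Longrightarrow> q \<in> I \<Longrightarrow> p * q \<in> I"
  shows "ideal I (poly_ring m n)"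
proof -
  interpret cring "poly_ring m n :: 'k var_poly ring" by (rule cring_poly_ring)
  have minus: "\<ominus>\<^bsub>poly_ring m n\<^esub> p = - p" if "p \<in> carrier (poly_ring m n)" for p :: "'k var_poly"
    by (rule minus_equality) (use that poly_ring_closed(5) in auto)
  have neg: "- p \<in> I" if "p \<in> I" for p
    using mult[OF poly_ring_closed(5)[OF poly_ring_closed(2)] that] by simp
  show ?thesis
  proof (rule idealI[OF ring_axioms])
    show "subgroup I (add_monoid (poly_ring m n))"
    proof (rule subgroup.intro)
      show "inv\<^bsub>add_monoid (poly_ring m n)\<^esub> p \<in> I" if "p \<in> I" for p
        using neg[OF that] minus[of p] sub that unfolding a_inv_def by auto
    qed (use sub zero add in auto)
  next
    fix p q :: "'k var_poly" assume pq: "p \<in> I" "q \<in> carrier (poly_ring m n)"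
    show "q \<otimes>\<^bsub>poly_ring m n\<^esub> p \<in> I" "p \<otimes>\<^bsub>poly_ring m n\<^esub> q \<in> I"
      using mult[OF pq(2,1)] by (simp_all add: mult.commute)
  qed
qed

lemma bordered_closed: "i < m \<Longrightarrow> c < n + m \<Longrightarrow> bordered n i c \<in> carrier (poly_ring m n)"
  using poly_ring_closed(1,2) by (auto simp: bordered_def var_in_poly_ring)

lemma bracket_closed:
  assumes C: "C \<in> col_sets m (n + m)"
  shows "(bracket m (bordered n) C :: 'k::field var_poly) \<in> carrier (poly_ring m n)"
proof -
  have sign: "(signof p :: 'k var_poly) \<in> carrier (poly_ring m n)" for p
    using signof_cases[of p, where ?'a = "'k var_poly"] poly_ring_closed(2)
      poly_ring_closed(5)[OF poly_ring_closed(2)] by auto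
  show ?thesis
    unfolding bracket_def fdet_leibniz_cols
    by (intro poly_ring_sum_closed poly_ring_prod_closed poly_ring_closed(4) sign bordered_closed)
      (auto simp: permutes_in_image pick_col_set(2)[OF C])
qed

lemma bracket_prod_closed: "set L \<subseteq> col_sets m (n + m) \<Longrightarrow> bracket_prod m (bordered n) L \<in> carrier (poly_ring m n)"
  by (induction L) (auto intro: poly_ring_closed bracket_closed)

section \<open>Brackets are the minors of the generic matrix\<close>

text \<open>
  Put first the rows outside \<open>I\<close> and the unit columns belonging to them. The matrix becomes block
  upper triangular, with an identity matrix and the submatrix for \<open>I\<close> and \<open>J\<close> on the diagonal.
\<close>

lemma det_submatrix_bracket:
  assumes I: "I \<subseteq> {..<m}" "card I = t" and J: "J \<subseteq> {..<n}" "card J = t"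
  shows "(bracket m (bordered n) (J \<union> (+) n ` ({..<m} - I)) :: 'k::field var_poly) \<in>
    {det (submatrix (generic_mat m n) I J), - det (submatrix (generic_mat m n) I J)}"
proof -
  let ?I' = "{..<m} - I" and ?s = "m - t"
  let ?C = "J \<union> (+) n ` ?I'"
  have fin: "finite I" "finite J" using I J finite_subset by auto
  have tm: "t \<le> m" using card_mono[OF _ I(1)] I(2) by simp
  then have st: "?s + t = m" by simp
  have cI': "card ?I' = ?s" using I fin by (simp add: card_Diff_subset)
  have pI': "inj_on (pick ?I') {..<?s}" "pick ?I' ` {..<?s} = ?I'"
    using pick_enumerates[of ?I'] cI' by auto
  have pI: "inj_on (pick I) {..<t}" "pick I ` {..<t} = I"
    using pick_enumerates[OF fin(1)] I(2) by auto
  have pJ: "inj_on (pick J) {..<t}" "pick J ` {..<t} = J"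
    using pick_enumerates[OF fin(2)] J(2) by auto
  define \<rho> where "\<rho> i = (if i < ?s then pick ?I' i else pick I (i - ?s))" for i
  define \<kappa> where "\<kappa> j = (if j < ?s then n + pick ?I' j else pick J (j - ?s))" for j
  have \<rho>: "inj_on \<rho> {..<m}" "\<rho> ` {..<m} = {..<m}"
    using append_enumerations[OF pI'(1) pI(1)] I(1) unfolding \<rho>_def pI'(2) pI(2) st by auto
  have nI': "inj_on (\<lambda>j. n + pick ?I' j) {..<?s}" "(\<lambda>j. n + pick ?I' j) ` {..<?s} = (+) n ` ?I'"
  proof -
    show "inj_on (\<lambda>j. n + pick ?I' j) {..<?s}"
      using pI'(1) by (simp add: inj_on_def)
    have "(\<lambda>j. n + pick ?I' j) ` {..<?s} = (+) n ` pick ?I' ` {..<?s}"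
      by (simp only: image_image)
    then show "(\<lambda>j. n + pick ?I' j) ` {..<?s} = (+) n ` ?I'"
      unfolding pI'(2) .
  qed
  have disj: "(+) n ` ?I' \<inter> J = {}" using J(1) by auto
  have \<kappa>: "inj_on \<kappa> {..<m}" "\<kappa> ` {..<m} = ?C"
    using append_enumerations[OF nI'(1) pJ(1)] disj unfolding \<kappa>_def nI'(2) pJ(2) st by auto
  have cC: "card ?C = m" using card_image[OF \<kappa>(1)] \<kappa>(2) by simp
  have pC: "inj_on (pick ?C) {..<m}" "pick ?C ` {..<m} = ?C"
    using pick_enumerates[of ?C] fin cC by auto
  have "fdet (?s + t) (\<lambda>i j. bordered n (\<rho> i) (\<kappa> j)) =
    fdet ?s (\<lambda>i j. bordered n (\<rho> i) (\<kappa> j)) * (fdet t (\<lambda>i j. bordered n (\<rho> (?s + i)) (\<kappa> (?s + j))) :: 'k var_poly)"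
  proof (rule fdet_block)
    fix i j assume ij: "?s \<le> i" "i < ?s + t" "j < ?s"
    then have "pick I (i - ?s) \<in> I" "pick ?I' j \<in> ?I'"
      using pI(2) pI'(2) by auto
    then show "bordered n (\<rho> i) (\<kappa> j) = (0 :: 'k var_poly)"
      using ij by (auto simp: \<rho>_def \<kappa>_def bordered_def)
  qed
  also have "fdet ?s (\<lambda>i j. bordered n (\<rho> i) (\<kappa> j)) = det (1\<^sub>m ?s :: 'k var_poly mat)"
    using inj_onD[OF pI'(1)] by (intro arg_cong[of _ _ det] eq_matI) (auto simp: \<rho>_def \<kappa>_def bordered_def)
  also have "fdet t (\<lambda>i j. bordered n (\<rho> (?s + i)) (\<kappa> (?s + j))) = (det (submatrix (generic_mat m n) I J) :: 'k var_poly)"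
  proof -
    have rows: "{i. i < m \<and> i \<in> I} = I" and cols: "{j. j < n \<and> j \<in> J} = J" using I J by auto
    have "pick I i < m" "pick J i < n" if "i < t" for i
      using that pI(2) pJ(2) I(1) J(1) by auto
    then show ?thesis
      using I(2) J(2)
      by (intro arg_cong[of _ _ det] eq_matI)
        (auto simp: \<rho>_def \<kappa>_def bordered_def submatrix_def generic_mat_def rows cols)
  qed
  finally have "fdet m (\<lambda>i j. bordered n (\<rho> i) (\<kappa> j)) = (det (submatrix (generic_mat m n) I J) :: 'k var_poly)"
    unfolding st by simp
  moreover have "bracket m (bordered n) ?C \<in> {fdet m (\<lambda>i j. bordered n (\<rho> i) (\<kappa> j)),
      - (fdet m (\<lambda>i j. bordered n (\<rho> i) (\<kappa> j)) :: 'k var_poly)}"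
    unfolding bracket_def
    using fdet_reindex[of "\<lambda>i. i" m \<rho> "pick ?C" \<kappa> "bordered n"] \<rho> \<kappa> pC by simp
  ultimately show ?thesis by simp
qed

lemma bracket_col_set_minor:
  assumes C: "C \<in> col_sets m (n + m)"
  obtains I where "I \<subseteq> {..<m}" "card I = card (C \<inter> {..<n})" "C = (C \<inter> {..<n}) \<union> (+) n ` ({..<m} - I)"
proof
  let ?I = "{i. i < m \<and> n + i \<notin> C}"
  have I': "{..<m} - ?I = {i. i < m \<and> n + i \<in> C}" by auto
  show "?I \<subseteq> {..<m}" by auto
  have C': "C \<inter> {n..} = (+) n ` ({..<m} - ?I)"
  proof
    show "C \<inter> {n..} \<subseteq> (+) n ` ({..<m} - ?I)"
    proof
      fix c assume "c \<in> C \<inter> {n..}"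
      moreover from this have "c < n + m" using col_setsD(1)[OF C] by auto
      ultimately show "c \<in> (+) n ` ({..<m} - ?I)"
        by (intro image_eqI[of _ _ "c - n"]) auto
    qed
  qed auto
  then show "C = (C \<inter> {..<n}) \<union> (+) n ` ({..<m} - ?I)" by auto
  have "card ({..<m} - ?I) = m - card ?I"
    by (subst card_Diff_subset) auto
  then have "card (C \<inter> {n..}) = m - card ?I"
    unfolding C' by (simp add: card_image)
  moreover have "card ?I \<le> m"
    using card_mono[of "{..<m}" ?I] by auto
  ultimately show "card ?I = card (C \<inter> {..<n})"
    using card_Int_lessThan_add[of C n] col_setsD[OF C] by simp
qed

section \<open>Ideals of minors as spans of standard products\<close>

text \<open>
  The brackets standing for minors of size at least \<open>t\<close> with at least \<open>r\<close> columns among the first \<open>a\<close>.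
\<close>

definition wide_cols :: "nat \<Rightarrow> nat \<Rightarrow> nat \<Rightarrow> nat \<Rightarrow> nat \<Rightarrow> nat set set" where
  "wide_cols m n a t r = {C \<in> col_sets m (n + m). t \<le> card (C \<inter> {..<n}) \<and> r \<le> card (C \<inter> {..<a})}"

lemma dim_generic_mat [simp]: "dim_row (generic_mat m n) = m" "dim_col (generic_mat m n) = n"
  by (simp_all add: generic_mat_def)

text \<open>
  Induction on the excess of the size of the minor over \<open>t\<close>. If the minor is too large, some column
  \<open>c\<close> can be spared without violating the bound \<open>r\<close>: one beyond the first \<open>a\<close>, or else any column, as
  then more than \<open>t \<ge> r\<close> columns are among the first \<open>a\<close>. Expanding along \<open>c\<close> replaces it by unit
  vectors, which yields smaller minors.
\<close>

lemma bracket_in_ideal: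
  fixes I :: "'k::field var_poly set"
  assumes I: "ideal I (poly_ring m n)" and gens: "minors_involving t r {..<a} (generic_mat m n) \<subseteq> I"
    and a: "a \<le> n" and r: "r \<le> t"
  shows "C \<in> wide_cols m n a t r \<Longrightarrow> bracket m (bordered n) C \<in> I"
proof (induction "card (C \<inter> {..<n}) - t" arbitrary: C)
  case 0
  then have C: "C \<in> col_sets m (n + m)" and ct: "card (C \<inter> {..<n}) = t" and cr: "r \<le> card (C \<inter> {..<a})"
    by (auto simp: wide_cols_def)
  obtain K where K: "K \<subseteq> {..<m}" "card K = t" "C = (C \<inter> {..<n}) \<union> (+) n ` ({..<m} - K)"
    by (rule bracket_col_set_minor[OF C, unfolded ct])
  have "(C \<inter> {..<n}) \<inter> {..<a} = C \<inter> {..<a}" using a by auto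
  then have "det (submatrix (generic_mat m n) K (C \<inter> {..<n})) \<in> I"
    unfolding minors_involving_def using K(1,2) ct cr
    by (intro subsetD[OF gens, unfolded minors_involving_def] CollectI exI[of _ K] exI[of _ "C \<inter> {..<n}"]) simp
  moreover have "bracket m (bordered n) C \<in> {det (submatrix (generic_mat m n) K (C \<inter> {..<n})),
      - (det (submatrix (generic_mat m n) K (C \<inter> {..<n})) :: 'k var_poly)}"
    using det_submatrix_bracket[OF K(1,2) _ ct, of n, where ?'k = 'k] unfolding K(3)[symmetric] by auto
  ultimately show ?case
    using ideal_poly_ringD(5)[OF I] by auto
next
  case (Suc d)
  then have C: "C \<in> col_sets m (n + m)" and ct: "t < card (C \<inter> {..<n})" and cr: "r \<le> card (C \<inter> {..<a})"
    by (auto simp: wide_cols_def)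
  note finC = col_setsD(3)[OF C]
  obtain c where c: "c \<in> C" "c < n" "r \<le> card (C \<inter> {..<a} - {c})"
  proof (cases "C \<inter> {..<n} \<subseteq> {..<a}")
    case True
    then have eq: "C \<inter> {..<n} = C \<inter> {..<a}" using a by auto
    have ca: "t < card (C \<inter> {..<a})" using ct unfolding eq .
    then have "C \<inter> {..<a} \<noteq> {}" by auto
    then obtain c where c: "c \<in> C \<inter> {..<a}" by blast
    then have "card (C \<inter> {..<a} - {c}) = card (C \<inter> {..<a}) - 1"
      by (rule card_Diff_singleton)
    then have "r \<le> card (C \<inter> {..<a} - {c})"
      using ca r by simp
    then show ?thesis using that[of c] c eq by blast
  next
    case False
    then obtain c where c: "c \<in> C \<inter> {..<n}" "c \<notin> {..<a}" by blast
    then have "C \<inter> {..<a} - {c} = C \<inter> {..<a}" by blast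
    then show ?thesis using that[of c] c(1) cr by simp
  qed
  obtain j0 where j0: "j0 < m" "pick C j0 = c"
    using pick_enumerates(2)[OF finC] col_setsD(2)[OF C] c(1) by (metis image_iff lessThan_iff)
  have pinj: "inj_on (pick C) {..<m}"
    using pick_enumerates(1)[OF finC] col_setsD(2)[OF C] by simp
  let ?s = "\<lambda>i x. if x = c then n + i else x"
  have summand: "var i c * fdet m (\<lambda>k l. bordered n k (?s i (pick C l))) \<in> I" if i: "i < m" for i
  proof (rule ideal_poly_ringD(4)[OF I var_in_poly_ring[OF i c(2)]])
    show "fdet m (\<lambda>k l. bordered n k (?s i (pick C l))) \<in> I"
    proof (cases "inj_on (?s i) C")
      case True
      define D where "D = ?s i ` C"
      have eq: "D \<inter> {..<b} = C \<inter> {..<b} - {c}" if "b \<le> n" for b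
        using that by (auto simp: D_def)
      have "D \<subseteq> {..<n + m}" using col_setsD(1)[OF C] i by (auto simp: D_def)
      then have "D \<in> col_sets m (n + m)"
        using card_image[OF True] col_setsD(2)[OF C] by (simp add: col_sets_def D_def)
      moreover have cn: "card (D \<inter> {..<n}) = card (C \<inter> {..<n}) - 1"
        unfolding eq[OF order_refl] using c by (simp add: card_Diff_singleton)
      ultimately have "D \<in> wide_cols m n a t r"
        using ct c(3) eq[OF a] by (simp add: wide_cols_def)
      then have "bracket m (bordered n) D \<in> I"
        using Suc.hyps(2) cn by (intro Suc.hyps(1)) auto
      moreover have "fdet m (\<lambda>k l. bordered n k (?s i (pick C l))) \<in> {bracket m (bordered n) D, - bracket m (bordered n) D :: 'k var_poly}"
        unfolding D_def by (rule fdet_cols_bracket(1)[OF finC col_setsD(2)[OF C] True])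
      ultimately show ?thesis
        using ideal_poly_ringD(5)[OF I] by (elim insertE emptyE) simp_all
    next
      case False
      then show ?thesis
        unfolding fdet_cols_bracket(2)[OF finC col_setsD(2)[OF C] False] by (intro ideal_poly_ringD(2)[OF I])
    qed
  qed
  have "bracket m (bordered n) C = (\<Sum>i<m. bordered n i (pick C j0) *
      (fdet m (\<lambda>k l. if l = j0 then (if k = i then 1 else 0) else bordered n k (pick C l)) :: 'k var_poly))"
    unfolding bracket_def by (rule fdet_expand_col[OF j0(1)])
  also have "\<dots> = (\<Sum>i<m. var i c * fdet m (\<lambda>k l. bordered n k (?s i (pick C l))))"
  proof (intro sum.cong refl arg_cong2[of _ _ _ _ "(*)"] fdet_cong)
    show "bordered n i (pick C j0) = var i c" for i
      using j0(2) c(2) by (simp add: bordered_def)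
    fix i k l assume kl: "k < m" "l < m"
    show "(if l = j0 then (if k = i then 1 else 0) else bordered n k (pick C l)) = (bordered n k (?s i (pick C l)) :: 'k var_poly)"
    proof (cases "l = j0")
      case True
      then show ?thesis using j0(2) by (simp add: bordered_def)
    next
      case False
      then have "pick C l \<noteq> c"
        using inj_onD[OF pinj, of l j0] j0 kl(2) by auto
      with False show ?thesis by simp
    qed
  qed
  also have "\<dots> \<in> I"
    by (rule ideal_poly_ring_sum[OF I], rule summand) simp
  finally show ?case .
qed

lemma span_mult:
  fixes A B D :: "'k::field var_poly set"
  assumes "\<And>x y. x \<in> A \<Longrightarrow> y \<in> B \<Longrightarrow> x * y \<in> kspan.span D"
    and "p \<in> kspan.span A" "q \<in> kspan.span B"
  shows "p * q \<in> kspan.span D"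
proof -
  have lin: "kspan.subspace {y. x * y \<in> kspan.span D}" for x
  proof (rule kspan.subspaceI; simp)
    show "0 \<in> kspan.span D" by (rule kspan.span_zero)
    show "x * (y + z) \<in> kspan.span D" if "x * y \<in> kspan.span D" "x * z \<in> kspan.span D" for y z
      using kspan.span_add[OF that] by (simp add: distrib_left)
    show "x * (Poly_Mapping.single 0 c * y) \<in> kspan.span D" if "x * y \<in> kspan.span D" for c y
      using kspan.span_scale[OF that, of c] by (simp add: mult.left_commute)
  qed
  have "x * q \<in> kspan.span D" if "x \<in> A" for x
    using kspan.span_minimal[OF _ lin[of x], of B] assms(1)[OF that] assms(3) by auto
  then show ?thesis
    using kspan.span_minimal[OF _ lin[of q], of A] assms(2) by (auto simp: mult.commute)
qed

definition col_lists :: "nat \<Rightarrow> nat \<Rightarrow> nat set list set" where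
  "col_lists m n = {L. set L \<subseteq> col_sets m (n + m)}"

text \<open>A variable is a \<open>1\<close>-minor, hence a bracket up to sign.\<close>

lemma var_in_span:
  assumes "i < m" "j < n"
  shows "(var i j :: 'k::field var_poly) \<in> kspan.span (bracket_prod m (bordered n) ` col_lists m n)"
proof -
  let ?C = "{j} \<union> (+) n ` ({..<m} - {i})"
  have "card ((+) n ` ({..<m} - {i})) = m - 1"
    using assms(1) by (simp add: card_image)
  then have "?C \<in> col_sets m (n + m)"
    using assms by (auto simp: col_sets_def card_insert_if)
  then have "bracket_prod m (bordered n) [?C] \<in> kspan.span (bracket_prod m (bordered n) ` col_lists m n)"
    by (intro kspan.span_base imageI) (simp add: col_lists_def)
  then have br: "bracket m (bordered n) ?C \<in> (kspan.span (bracket_prod m (bordered n) ` col_lists m n) :: 'k var_poly set)"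
    by simp
  have "{k. k < m \<and> k \<in> {i}} = {i}" "{k. k < n \<and> k \<in> {j}} = {j}"
    using assms by auto
  moreover have "pick {k} 0 = k" for k
    by (simp add: Least_equality)
  ultimately have "submatrix (generic_mat m n) {i} {j} = mat 1 1 (\<lambda>_. var i j :: 'k var_poly)"
    unfolding submatrix_def generic_mat_def using assms by (intro eq_matI) (simp_all del: pick.simps)
  then have "det (submatrix (generic_mat m n) {i} {j}) = (var i j :: 'k var_poly)"
    by (simp add: det_single)
  then have "bracket m (bordered n) ?C \<in> {var i j, - var i j :: 'k var_poly}"
    using det_submatrix_bracket[of "{i}" m 1 "{j}" n, where ?'k = 'k] assms by simp
  then show ?thesis
    using br kspan.span_neg[OF br] by auto
qed

lemma carrier_subset_span:
  "carrier (poly_ring m n) \<subseteq> (kspan.span (bracket_prod m (bordered n) ` col_lists m n) :: 'k::field var_poly set)"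
    (is "_ \<subseteq> ?W")
proof
  have "bracket_prod m (bordered n) [] \<in> ?W"
    by (intro kspan.span_base imageI) (simp add: col_lists_def)
  then have one: "1 \<in> ?W" by simp
  have mult: "p * q \<in> ?W" if "p \<in> ?W" "q \<in> ?W" for p q
  proof (rule span_mult[OF _ that])
    fix x y :: "'k var_poly"
    assume "x \<in> bracket_prod m (bordered n) ` col_lists m n" "y \<in> bracket_prod m (bordered n) ` col_lists m n"
    then obtain K L where "x = bracket_prod m (bordered n) K" "y = bracket_prod m (bordered n) L" "K @ L \<in> col_lists m n"
      by (auto simp: col_lists_def)
    then show "x * y \<in> ?W"
      by (simp add: bracket_prod_simps(3)[symmetric] kspan.span_base del: bracket_prod_simps(3))
  qed
  have power: "p ^ e \<in> ?W" if "p \<in> ?W" for p e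
    using that by (induction e) (auto intro: one mult)
  have prod: "prod f A \<in> ?W" if "\<And>v. v \<in> A \<Longrightarrow> f v \<in> ?W" for f :: "nat \<times> nat \<Rightarrow> 'k var_poly" and A
    using that by (induction A rule: infinite_finite_induct) (auto intro: one mult)
  have var_power: "Poly_Mapping.single (Poly_Mapping.single (i, j) e) (1 :: 'k) = var i j ^ e" for i j e
  proof (induction e)
    case (Suc e)
    have "Poly_Mapping.single (Poly_Mapping.single (i, j) (Suc e)) (1 :: 'k) =
      var i j * Poly_Mapping.single (Poly_Mapping.single (i, j) e) 1"
      by (simp add: var_def mult_single single_add[symmetric])
    then show ?case by (simp add: Suc.IH)
  qed simp
  fix p :: "'k var_poly" assume p: "p \<in> carrier (poly_ring m n)"
  have "Poly_Mapping.single \<mu> (c :: 'k) \<in> ?W" if \<mu>: "\<mu> \<in> Poly_Mapping.keys p" for \<mu> c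
  proof -
    have "Poly_Mapping.single \<mu> (1 :: 'k) =
      Poly_Mapping.single (\<Sum>v\<in>Poly_Mapping.keys \<mu>. Poly_Mapping.single v (Poly_Mapping.lookup \<mu> v)) 1"
      using poly_mapping_sum_single[of \<mu>] by simp
    also have "\<dots> = (\<Prod>v\<in>Poly_Mapping.keys \<mu>. Poly_Mapping.single (Poly_Mapping.single v (Poly_Mapping.lookup \<mu> v)) 1)"
      by (rule prod_single_one[symmetric])
    also have "\<dots> \<in> ?W"
    proof (rule prod)
      fix v assume "v \<in> Poly_Mapping.keys \<mu>"
      then have "v \<in> {..<m} \<times> {..<n}"
        using p \<mu> by (auto simp: carrier_poly_ring_iff)
      then show "Poly_Mapping.single (Poly_Mapping.single v (Poly_Mapping.lookup \<mu> v)) 1 \<in> ?W"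
        by (auto simp: var_power intro!: power var_in_span)
    qed
    finally have "Poly_Mapping.single \<mu> (1 :: 'k) \<in> ?W" .
    then have "Poly_Mapping.single 0 c * Poly_Mapping.single \<mu> 1 \<in> ?W"
      by (rule kspan.span_scale)
    then show ?thesis by (simp add: mult_single)
  qed
  then have "(\<Sum>\<mu>\<in>Poly_Mapping.keys p. Poly_Mapping.single \<mu> (Poly_Mapping.lookup p \<mu>)) \<in> ?W"
    by (intro kspan.span_sum) auto
  then show "p \<in> ?W"
    by (simp only: poly_mapping_sum_single[symmetric])
qed

lemma pick_atLeastLessThan: "j < m \<Longrightarrow> pick {n..<n + m} j = n + j"
proof (induction j)
  case 0
  then show ?case by (auto intro!: Least_equality)
next
  case (Suc j)
  then show ?case by (auto intro!: Least_equality)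
qed

lemma bracket_top: "bracket m (bordered n) {n..<n + m} = 1"
proof -
  have "bracket m (bordered n) {n..<n + m} = det (1\<^sub>m m)"
    unfolding bracket_def by (intro arg_cong[of _ _ det] eq_matI) (auto simp: pick_atLeastLessThan bordered_def)
  then show ?thesis by simp
qed

lemma bracket_prod_filter_top: "bracket_prod m (bordered n) (filter (\<lambda>C. C \<noteq> {n..<n + m}) L) = bracket_prod m (bordered n) L"
  by (induction L) (auto simp: bracket_top)

lemma col_le_top:
  assumes D: "D \<in> col_sets m (n + m)" and le: "col_le {n..<n + m} D"
  shows "D = {n..<n + m}"
proof -
  have "card (D \<inter> {..<n}) \<le> card ({n..<n + m} \<inter> {..<n})"
    using le by (simp add: col_le_def)
  also have "{n..<n + m} \<inter> {..<n} = {}" by auto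
  finally have "D \<inter> {..<n} = {}" using col_setsD[OF D] by simp
  then have "D \<subseteq> {n..<n + m}" using col_setsD[OF D] by (auto simp: not_less[symmetric])
  then show ?thesis using col_setsD[OF D] by (intro card_subset_eq) auto
qed

text \<open>
  Appending the trivial bracket gives the empty chain a first member; its product \<open>1\<close> is that of
  the trivial bracket.
\<close>

definition std_chains_from :: "nat \<Rightarrow> nat \<Rightarrow> nat set set \<Rightarrow> nat set list set" where
  "std_chains_from m n W = {L \<in> std_chains m n. hd (L @ [{n..<n + m}]) \<in> W}"

text \<open>
  Straightening may produce trivial brackets. They are last in the order, so dropping them keeps the
  first member of a chain unless the chain consists of trivial brackets only.
\<close>

lemma bracket_prod_in_std_span:
  assumes L: "set L \<subseteq> col_sets m (n + m)" "L \<noteq> []" and hd: "hd L \<in> wide_cols m n a t r"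
  shows "(bracket_prod m (bordered n) L :: 'k::field var_poly) \<in>
    kspan.span (bracket_prod m (bordered n) ` std_chains_from m n (wide_cols m n a t r))" (is "_ \<in> ?S")
proof -
  let ?top = "{n..<n + m}"
  have "bracket_prod m (bordered n) ` {K. K \<noteq> [] \<and> set K \<subseteq> col_sets m (n + m) \<and> sorted_wrt col_le K \<and> col_le (hd K) (hd L)} \<subseteq> ?S"
  proof clarify
    fix K assume K: "K \<noteq> []" "set K \<subseteq> col_sets m (n + m)" "sorted_wrt col_le K" "col_le (hd K) (hd L)"
    let ?K = "filter (\<lambda>C. C \<noteq> ?top) K"
    have "card (hd L \<inter> {..<x}) \<le> card (hd K \<inter> {..<x})" for x
      using K(4) by (simp add: col_le_def)
    from this[of n] this[of a] have "t \<le> card (hd K \<inter> {..<n})" "r \<le> card (hd K \<inter> {..<a})"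
      using hd by (simp_all add: wide_cols_def)
    then have hdK: "hd K \<in> wide_cols m n a t r"
      using K(1,2) by (auto simp: wide_cols_def)
    have "hd (?K @ [?top]) = hd K"
    proof (cases "hd K = ?top")
      case True
      obtain C K' where CK: "K = C # K'" using K(1) by (cases K) auto
      have "D = ?top" if "D \<in> set K" for D
      proof (rule col_le_top)
        show "D \<in> col_sets m (n + m)" using that K(2) by auto
        show "col_le ?top D" using that K(3) True unfolding CK by auto
      qed
      then have "?K = []" by (simp add: filter_empty_conv)
      then show ?thesis using True by simp
    next
      case False
      then show ?thesis using K(1) by (cases K) auto
    qed
    then have "?K \<in> std_chains_from m n (wide_cols m n a t r)"
      using K(2,3) hdK by (auto simp: std_chains_from_def std_chains_def sorted_wrt_filter)
    then have "bracket_prod m (bordered n) ?K \<in> ?S"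
      by (intro kspan.span_base imageI)
    then show "bracket_prod m (bordered n) K \<in> ?S"
      unfolding bracket_prod_filter_top .
  qed
  from kspan.span_minimal[OF this kspan.subspace_span] show ?thesis
    using straightening[OF L, of "bordered n"] by blast
qed

text \<open>
  Products of brackets with a first factor in \<open>wide_cols m n a t r\<close> span an ideal, because products
  of brackets span the whole ring and further factors can be appended at the end. It contains the
  generators, and straightening expresses it by standard products. Conversely the first factor of
  each such standard product is in the ideal of minors.
\<close>

theorem Idl_minors_involving_eq_span:
  assumes a: "a \<le> n" and r: "r \<le> t"
  shows "Idl\<^bsub>poly_ring m n\<^esub> (minors_involving t r {..<a} (generic_mat m n :: 'k::field var_poly mat)) =
    kspan.span (bracket_prod m (bordered n) ` std_chains_from m n (wide_cols m n a t r))" (is "?I = ?S")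
proof -
  interpret R: cring "poly_ring m n :: 'k var_poly ring" by (rule cring_poly_ring)
  let ?gens = "minors_involving t r {..<a} (generic_mat m n :: 'k var_poly mat)"
  let ?W = "wide_cols m n a t r"
  let ?P = "{L. L \<noteq> [] \<and> set L \<subseteq> col_sets m (n + m) \<and> hd L \<in> ?W}"
  let ?T = "kspan.span (bracket_prod m (bordered n) ` ?P) :: 'k var_poly set"
  have carrier: "kspan.subspace (carrier (poly_ring m n) :: 'k var_poly set)"
    by (rule kspan.subspaceI) (auto intro: poly_ring_closed)
  have T_carrier: "?T \<subseteq> carrier (poly_ring m n)"
    by (rule kspan.span_minimal[OF _ carrier]) (auto intro: bracket_prod_closed)
  have ideal_T: "ideal ?T (poly_ring m n)"
  proof (rule ideal_poly_ringI[OF T_carrier kspan.span_zero kspan.span_add])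
    fix p q :: "'k var_poly"
    assume p: "p \<in> carrier (poly_ring m n)" and q: "q \<in> ?T"
    show "p * q \<in> ?T"
    proof (rule span_mult[OF _ subsetD[OF carrier_subset_span p] q])
      fix x y :: "'k var_poly"
      assume "x \<in> bracket_prod m (bordered n) ` col_lists m n" "y \<in> bracket_prod m (bordered n) ` ?P"
      then obtain K L where KL: "x = bracket_prod m (bordered n) K" "y = bracket_prod m (bordered n) L" "L @ K \<in> ?P"
        by (auto simp: col_lists_def)
      have "bracket_prod m (bordered n) (L @ K) \<in> ?T"
        using KL(3) by (intro kspan.span_base imageI)
      then show "x * y \<in> ?T"
        by (simp add: KL(1,2) mult.commute)
    qed
  qed
  have gens_T: "?gens \<subseteq> ?T"
  proof
    fix d assume "d \<in> ?gens"
    then obtain I J where IJ: "I \<subseteq> {..<m}" "card I = t" "J \<subseteq> {..<n}" "card J = t"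
      and rJ: "r \<le> card (J \<inter> {..<a})" and d: "d = det (submatrix (generic_mat m n) I J)"
      by (auto simp: minors_involving_def)
    let ?C = "J \<union> (+) n ` ({..<m} - I)"
    have fin: "finite I" "finite J" using IJ finite_subset by auto
    have tm: "t \<le> m" using card_mono[OF _ IJ(1)] IJ(2) by simp
    have "card ?C = card J + card ((+) n ` ({..<m} - I))"
      using IJ(3) fin by (intro card_Un_disjoint) auto
    also have "\<dots> = m"
      using IJ fin tm by (simp add: card_image card_Diff_subset)
    finally have "?C \<in> col_sets m (n + m)"
      using IJ(3) by (auto simp: col_sets_def)
    moreover have "?C \<inter> {..<n} = J" "?C \<inter> {..<a} = J \<inter> {..<a}"
      using IJ(3) a by auto
    ultimately have "[?C] \<in> ?P"
      using IJ(4) rJ by (simp add: wide_cols_def)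
    then have "bracket_prod m (bordered n) [?C] \<in> ?T"
      by (intro kspan.span_base imageI)
    then have br: "bracket m (bordered n) ?C \<in> ?T" by simp
    have "bracket m (bordered n) ?C \<in> {d, - d}"
      unfolding d by (rule det_submatrix_bracket[OF IJ])
    then show "d \<in> ?T"
      using br kspan.span_neg[OF br] by auto
  qed
  have "?T \<subseteq> ?S"
    by (rule kspan.span_minimal[OF _ kspan.subspace_span]) (auto intro: bracket_prod_in_std_span)
  then have "?I \<subseteq> ?S"
    using R.genideal_minimal[OF ideal_T gens_T] by simp
  moreover have "?S \<subseteq> ?I"
  proof (rule kspan.span_minimal)
    have I: "ideal ?I (poly_ring m n)"
      using gens_T T_carrier by (intro R.genideal_ideal) simp
    have gens: "?gens \<subseteq> ?I"
      using gens_T T_carrier by (intro R.genideal_self) simp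
    note br = bracket_in_ideal[OF I gens a r]
    show "kspan.subspace ?I"
      by (rule kspan.subspaceI) (auto intro: ideal_poly_ringD[OF I] poly_ring_closed(6))
    show "bracket_prod m (bordered n) ` std_chains_from m n ?W \<subseteq> ?I"
    proof clarify
      fix L assume L: "L \<in> std_chains_from m n ?W"
      show "bracket_prod m (bordered n) L \<in> ?I"
      proof (cases L)
        case Nil
        then have "{n..<n + m} \<in> ?W" using L by (simp add: std_chains_from_def)
        then show ?thesis using br bracket_top[of m n, where ?'a = 'k] Nil by fastforce
      next
        case (Cons C K)
        then have "C \<in> ?W" "set K \<subseteq> col_sets m (n + m)"
          using L by (auto simp: std_chains_from_def std_chains_def)
        then have "bracket_prod m (bordered n) K * bracket m (bordered n) C \<in> ?I"
          by (intro ideal_poly_ringD(4)[OF I] br bracket_prod_closed)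
        then show ?thesis by (simp add: Cons mult.commute)
      qed
    qed
  qed
  ultimately show ?thesis by blast
qed

theorem theorem1p1:
  fixes m n a t r :: nat
    and A B :: "'k::field var_poly mat"
  assumes "a \<le> n" and "r \<le> t"
    and "A \<in> carrier_mat m a" and "B \<in> carrier_mat m (n - a)"
    and "generic_mat m n = four_block_mat A B (0\<^sub>m 0 a) (0\<^sub>m 0 (n - a))"
  shows "Idl\<^bsub>poly_ring m n\<^esub> (minors_involving t r {..<a} (generic_mat m n :: 'k var_poly mat)) =
    Idl\<^bsub>poly_ring m n\<^esub> (minors t (generic_mat m n)) \<inter> Idl\<^bsub>poly_ring m n\<^esub> (minors r A)"
proof -
  let ?X = "generic_mat m n :: 'k var_poly mat"
  have It: "minors t ?X = minors_involving t 0 {..<a} ?X"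
    by (simp add: minors_def minors_involving_def)
  have entry: "A $$ (i, j) = ?X $$ (i, j)" if "i < m" "j < a" for i j
    using that assms(1,3,4) unfolding assms(5) by simp
  have sub: "submatrix A I J = submatrix ?X I J" if IJ: "I \<subseteq> {..<m}" "J \<subseteq> {..<a}" for I J
  proof -
    have sets: "{i. i < m \<and> i \<in> I} = I" "{j. j < a \<and> j \<in> J} = J" "{j. j < n \<and> j \<in> J} = J"
      using IJ assms(1) by auto
    have "pick I i < m" if "i < card I" for i using pick_in_set_le[OF that] IJ(1) by auto
    moreover have "pick J j < a" if "j < card J" for j using pick_in_set_le[OF that] IJ(2) by auto
    ultimately show ?thesis
      using assms(3) entry by (intro eq_matI) (auto simp: submatrix_def sets)
  qed
  have full: "J \<subseteq> {..<n} \<and> card J = r \<and> r \<le> card (J \<inter> {..<a}) \<longleftrightarrow> J \<subseteq> {..<a} \<and> card J = r" for J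
  proof
    assume J: "J \<subseteq> {..<n} \<and> card J = r \<and> r \<le> card (J \<inter> {..<a})"
    then have "finite J" using finite_subset by auto
    then have "J \<inter> {..<a} = J" using J by (intro card_seteq) auto
    then show "J \<subseteq> {..<a} \<and> card J = r" using J by auto
  next
    assume J: "J \<subseteq> {..<a} \<and> card J = r"
    then have "J \<inter> {..<a} = J" by auto
    then show "J \<subseteq> {..<n} \<and> card J = r \<and> r \<le> card (J \<inter> {..<a})" using J assms(1) by auto
  qed
  have Ir: "minors r A = minors_involving r r {..<a} ?X"
    unfolding minors_def minors_involving_def carrier_matD[OF assms(3)] dim_generic_mat
  proof (intro Collect_cong ex_cong1)
    show "(d = det (submatrix A I J) \<and> I \<subseteq> {..<m} \<and> card I = r \<and> J \<subseteq> {..<a} \<and> card J = r) \<longleftrightarrow>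
      (d = det (submatrix ?X I J) \<and> I \<subseteq> {..<m} \<and> card I = r \<and> J \<subseteq> {..<n} \<and> card J = r \<and>
        r \<le> card (J \<inter> {..<a}))" for d I J
      unfolding full[of J] by (auto simp: sub)
  qed
  have "std_chains_from m n (wide_cols m n a t r) =
      std_chains_from m n (wide_cols m n a t 0) \<inter> std_chains_from m n (wide_cols m n a r r)"
  proof -
    have "C \<in> wide_cols m n a t r \<longleftrightarrow> C \<in> wide_cols m n a t 0 \<inter> wide_cols m n a r r" for C
    proof -
      have "card (C \<inter> {..<a}) \<le> card (C \<inter> {..<n})"
        using assms(1) by (intro card_mono) auto
      then show ?thesis using assms(2) by (auto simp: wide_cols_def)
    qed
    then have "wide_cols m n a t r = wide_cols m n a t 0 \<inter> wide_cols m n a r r"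
      by blast
    then show ?thesis by (auto simp: std_chains_from_def)
  qed
  moreover have "std_chains_from m n W \<subseteq> std_chains m n" for W
    by (auto simp: std_chains_from_def)
  ultimately show ?thesis
    unfolding It Ir Idl_minors_involving_eq_span[OF assms(1,2)]
      Idl_minors_involving_eq_span[OF assms(1) le0[of t]] Idl_minors_involving_eq_span[OF assms(1) order_refl]
    by (simp only: span_bracket_prod_Int)
qed

end
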